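(* Let $h\in\mathbb{R}$, $\delta\in(0,1)$ and $\epsilon>0$, and run Algorithm 1 (described in the context) with threshold $h$, accuracy parameter $\epsilon$ and $\beta=2\log(|\Omega|\,\delta^{-1})$. Then, with probability at least $1-\delta$, when Algorithm 1 completes classification (i.e. when $U_t=\emptyset$), with output $\widehat H,\widehat L$, the misspecification loss of every point of $\Omega$ is at most $\epsilon$. That is, $$\mathrm{P}\Big(\max_{\bm{x}\in\Omega} e_h(\bm{x})\le\epsilon\Big)\ge 1-\delta ,$$ where for $\bm{x}\in\Omega$ $$e_h(\bm{x})=\begin{cases}\max\{0,\,f(\bm{x})-h\} & \text{if } \bm{x}\in\widehat L,\\ \max\{0,\,h-f(\bm{x})\} & \text{if } \bm{x}\in\widehat H.\end{cases}$$
   Context: Setting. $D\subset\mathbb{R}^d$, $\Omega\subset D$ is a nonempty finite set, and $f:D\to\mathbb{R}$ is a black-box function distributed according to a Gaussian process prior $\mathcal{GP}(0,k)$ with positive-definite kernel $k:D\times D\to\mathbb{R}$. There are costs $0<c_1<\dots<c_K$. If the point $\bm{x}\in\Omega$ is requested with cost $c_i$, the point actually evaluated is a random sample $\bm{s}\in D$ of a random variable $\bm{S}(\bm{x},c_i)$ with density $g(\cdot\mid\theta_{\bm{x}}^{(c_i)})$, and one observes $\bm{s}$ and $y=f(\bm{s})+\varrho$ with independent noise $\varrho\sim\mathcal{N}(0,\sigma^2)$, $\sigma^2>0$. Posterior. After $t$ trials with evaluated points $\bm{s}_1,\dots,\bm{s}_t$ and observations $\bm{y}_t=(y_1,\dots,y_t)^\top$,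 put $\bm{k}_t(\bm{x})=(k(\bm{s}_1,\bm{x}),\dots,k(\bm{s}_t,\bm{x}))^\top$, $\bm{K}_t=(k(\bm{s}_i,\bm{s}_j))_{i,j}$, $\bm{C}_t=\bm{K}_t+\sigma^2\bm{I}_t$, and $\mu_t(\bm{x})=\bm{k}_t(\bm{x})^\top\bm{C}_t^{-1}\bm{y}_t$, $k_t(\bm{x},\bm{x}')=k(\bm{x},\bm{x}')-\bm{k}_t(\bm{x})^\top\bm{C}_t^{-1}\bm{k}_t(\bm{x}')$, $\sigma_t^2(\bm{x})=k_t(\bm{x},\bm{x})$. (If a finite, possibly empty, set of initial training data from the same observation model is supplied, it is included in the conditioning as well.) Classification. For $\beta\ge0$, let $l_t(\bm{x})=\mu_t(\bm{x})-\beta^{1/2}\sigma_t(\bm{x})$, $u_t(\bm{x})=\mu_t(\bm{x})+\beta^{1/2}\sigma_t(\bm{x})$, and $H_t=\{\bm{x}\in\Omega: l_t(\bm{x})>h-\epsilon\}$, $L_t=\{\bm{x}\in\Omega: u_t(\bm{x})<h+\epsilon\}$, $U_t=\Omega\setminus(H_t\cup L_t)$ for $t\ge1$, with $U_0=\Omega$. Acquisition function. For a hypothetical new data point $(\bm{s}^*,y^* )$, let $HL_t(\bm{s}^*,y^* )$ be the union of the two estimated sets recomputed after adding $(\bm{s}^*,y^* )$ to the current data, let $HL_t=H_t\cup L_t$, and $a_t(\bm{x},c_i)=c_i^{-1}\big\{\int \mathrm{E}_{y^*}\big[|HL_t(\bm{s}^*,y^* )|\big]\,g(\bm{s}^*\mid\theta_{\bm{x}}^{(c_i)})\,d\bm{s}^*-|HL_t|\big\}$,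 where $y^*\sim\mathcal{N}(\mu_t(\bm{s}^* ),\sigma_t^2(\bm{s}^* )+\sigma^2)$. Algorithm 1. Given $p_1,p_2,\dots\in[0,1]$ and $\kappa_1,\dots,\kappa_K\in(0,1)$ with $|\Omega|\sum_{i=1}^K\kappa_i=1$. As long as $U_{t-1}\neq\emptyset$, trial $t$ is performed: draw independently $r_t\sim$ Bernoulli$(p_t)$; if $r_t=0$ choose $(\bm{x}_t,c_{i_t})$ maximizing the acquisition function (computed from the current data) over $\Omega\times\{c_1,\dots,c_K\}$; if $r_t=1$ draw $(\bm{x}_t,c_{i_t})=C_t$, where, independently of everything else, $\mathrm{P}(C_t=(\bm{x},c_i))=\kappa_i$ for each $\bm{x}\in\Omega$ and each $i$. Then sample $\bm{s}_t$ from $\bm{S}(\bm{x}_t,c_{i_t})$ (independently of the past given $(\bm{x}_t,c_{i_t})$), observe $y_t=f(\bm{s}_t)+\varrho_t$, and update. The algorithm completes at the first $t$ with $U_t=\emptyset$, and outputs $\widehat H=H_t$, $\widehat L=L_t$. Probability is over $f$, the noise, the input randomness and the algorithm's randomness. *)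

theory Defs
  imports "HOL-Probability.Probability" "Jordan_Normal_Form.Gauss_Jordan_Elimination"
begin

section \<open>Gaussian process prior\<close>

definition pos_def_kernel :: "'a set \<Rightarrow> ('a \<Rightarrow> 'a \<Rightarrow> real) \<Rightarrow> bool" where
  "pos_def_kernel D k \<longleftrightarrow>
     (\<forall>x\<in>D. \<forall>x'\<in>D. k x x' = k x' x) \<and>
     (\<forall>J a. finite J \<and> J \<subseteq> D \<longrightarrow> 0 \<le> (\<Sum>x\<in>J. \<Sum>x'\<in>J. a x * a x' * k x x'))"

text \<open>The normal law with mean \<open>m\<close> and variance \<open>v \<ge> 0\<close>; a point mass if \<open>v = 0\<close>.\<close>

definition normal_law :: "real \<Rightarrow> real \<Rightarrow> real measure" where
  "normal_law m v =
     (if v = 0 then return borel m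
      else density lborel (\<lambda>y. ennreal (normal_density m (sqrt v) y)))"

text \<open>The \<open>\<sigma>\<close>-algebra on \<open>space M\<close> generated by a family of maps with values in \<open>N\<close>.\<close>

definition generated_by :: "'w measure \<Rightarrow> 'i set \<Rightarrow> ('i \<Rightarrow> 'w \<Rightarrow> 'b) \<Rightarrow> 'b measure \<Rightarrow> 'w measure" where
  "generated_by M I X N =
     sigma (space M) {X i -` B \<inter> space M | i B. i \<in> I \<and> B \<in> sets N}"

text \<open>A family of random variables is a centred Gaussian process with covariance \<open>k\<close> if all its
  finite linear combinations are normal with the prescribed variance (possibly degenerate). The
  last clause is joint measurability of \<open>(x, \<omega>) \<mapsto> f x \<omega>\<close> with respect to the
  \<open>\<sigma>\<close>-algebra generated by the process itself; it makes the value of \<open>f\<close> at a random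
  point a random variable, and holds for instance if the sample paths are continuous.\<close>

definition gaussian_process ::
    "'w measure \<Rightarrow> 'a::euclidean_space set \<Rightarrow> ('a \<Rightarrow> 'a \<Rightarrow> real) \<Rightarrow> ('a \<Rightarrow> 'w \<Rightarrow> real) \<Rightarrow> bool" where
  "gaussian_process M D k f \<longleftrightarrow>
     (\<forall>x\<in>D. f x \<in> borel_measurable M) \<and>
     (\<forall>J a. finite J \<and> J \<subseteq> D \<longrightarrow>
        distr M borel (\<lambda>\<omega>. \<Sum>x\<in>J. a x * f x \<omega>)
          = normal_law 0 (\<Sum>x\<in>J. \<Sum>x'\<in>J. a x * a x' * k x x')) \<and>
     (\<lambda>(x, \<omega>). f x \<omega>)
       \<in> borel_measurable (restrict_space borel D \<Otimes>\<^sub>M generated_by M D f borel)"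


section \<open>Posterior\<close>

text \<open>Data are lists of pairs (evaluated point, observed value), in chronological order.\<close>

type_synonym 'a data = "('a \<times> real) list"

definition kernel_vec :: "('a \<Rightarrow> 'a \<Rightarrow> real) \<Rightarrow> 'a data \<Rightarrow> 'a \<Rightarrow> real Matrix.vec" where
  "kernel_vec k d x = Matrix.vec (length d) (\<lambda>i. k (fst (d ! i)) x)"

definition noisy_gram :: "('a \<Rightarrow> 'a \<Rightarrow> real) \<Rightarrow> real \<Rightarrow> 'a data \<Rightarrow> real Matrix.mat" where
  "noisy_gram k \<sigma> d =
     Matrix.mat (length d) (length d) (\<lambda>(i, j). k (fst (d ! i)) (fst (d ! j)))
       + \<sigma>\<^sup>2 \<cdot>\<^sub>m 1\<^sub>m (length d)"

definition noisy_gram_inv :: "('a \<Rightarrow> 'a \<Rightarrow> real) \<Rightarrow> real \<Rightarrow> 'a data \<Rightarrow> real Matrix.mat" where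
  "noisy_gram_inv k \<sigma> d = the (mat_inverse (noisy_gram k \<sigma> d))"

definition post_mean :: "('a \<Rightarrow> 'a \<Rightarrow> real) \<Rightarrow> real \<Rightarrow> 'a data \<Rightarrow> 'a \<Rightarrow> real" where
  "post_mean k \<sigma> d x =
     scalar_prod (kernel_vec k d x) (noisy_gram_inv k \<sigma> d *\<^sub>v vec_of_list (map snd d))"

definition post_cov :: "('a \<Rightarrow> 'a \<Rightarrow> real) \<Rightarrow> real \<Rightarrow> 'a data \<Rightarrow> 'a \<Rightarrow> 'a \<Rightarrow> real" where
  "post_cov k \<sigma> d x x' =
     k x x' - scalar_prod (kernel_vec k d x) (noisy_gram_inv k \<sigma> d *\<^sub>v kernel_vec k d x')"

definition post_var :: "('a \<Rightarrow> 'a \<Rightarrow> real) \<Rightarrow> real \<Rightarrow> 'a data \<Rightarrow> 'a \<Rightarrow> real" where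
  "post_var k \<sigma> d x = post_cov k \<sigma> d x x"


section \<open>Classification\<close>

definition lower_bd :: "('a \<Rightarrow> 'a \<Rightarrow> real) \<Rightarrow> real \<Rightarrow> real \<Rightarrow> 'a data \<Rightarrow> 'a \<Rightarrow> real" where
  "lower_bd k \<sigma> \<beta> d x = post_mean k \<sigma> d x - sqrt \<beta> * sqrt (post_var k \<sigma> d x)"

definition upper_bd :: "('a \<Rightarrow> 'a \<Rightarrow> real) \<Rightarrow> real \<Rightarrow> real \<Rightarrow> 'a data \<Rightarrow> 'a \<Rightarrow> real" where
  "upper_bd k \<sigma> \<beta> d x = post_mean k \<sigma> d x + sqrt \<beta> * sqrt (post_var k \<sigma> d x)"

text \<open>The argument \<open>t\<close> is the number of trials performed so far. Before the first trial nothing is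
  classified, even in the presence of initial training data, so that \<open>U\<^sub>0 = \<Omega>\<close>.\<close>

definition high_set ::
    "'a set \<Rightarrow> ('a \<Rightarrow> 'a \<Rightarrow> real) \<Rightarrow> real \<Rightarrow> real \<Rightarrow> real \<Rightarrow> real \<Rightarrow> nat \<Rightarrow> 'a data \<Rightarrow> 'a set" where
  "high_set \<Omega> k \<sigma> \<beta> h \<epsilon> t d =
     (if t = 0 then {} else {x \<in> \<Omega>. lower_bd k \<sigma> \<beta> d x > h - \<epsilon>})"

definition low_set ::
    "'a set \<Rightarrow> ('a \<Rightarrow> 'a \<Rightarrow> real) \<Rightarrow> real \<Rightarrow> real \<Rightarrow> real \<Rightarrow> real \<Rightarrow> nat \<Rightarrow> 'a data \<Rightarrow> 'a set" where
  "low_set \<Omega> k \<sigma> \<beta> h \<epsilon> t d =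
     (if t = 0 then {} else {x \<in> \<Omega>. upper_bd k \<sigma> \<beta> d x < h + \<epsilon>})"

definition classified_set ::
    "'a set \<Rightarrow> ('a \<Rightarrow> 'a \<Rightarrow> real) \<Rightarrow> real \<Rightarrow> real \<Rightarrow> real \<Rightarrow> real \<Rightarrow> nat \<Rightarrow> 'a data \<Rightarrow> 'a set" where
  "classified_set \<Omega> k \<sigma> \<beta> h \<epsilon> t d = high_set \<Omega> k \<sigma> \<beta> h \<epsilon> t d \<union> low_set \<Omega> k \<sigma> \<beta> h \<epsilon> t d"

definition unclassified_set ::
    "'a set \<Rightarrow> ('a \<Rightarrow> 'a \<Rightarrow> real) \<Rightarrow> real \<Rightarrow> real \<Rightarrow> real \<Rightarrow> real \<Rightarrow> nat \<Rightarrow> 'a data \<Rightarrow> 'a set" where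
  "unclassified_set \<Omega> k \<sigma> \<beta> h \<epsilon> t d = \<Omega> - classified_set \<Omega> k \<sigma> \<beta> h \<epsilon> t d"


section \<open>Acquisition function\<close>

definition expected_classified ::
    "'a set \<Rightarrow> ('a \<Rightarrow> 'a \<Rightarrow> real) \<Rightarrow> real \<Rightarrow> real \<Rightarrow> real \<Rightarrow> real \<Rightarrow> nat \<Rightarrow> 'a data \<Rightarrow> 'a \<Rightarrow> real" where
  "expected_classified \<Omega> k \<sigma> \<beta> h \<epsilon> t d s =
     (LINT y|normal_law (post_mean k \<sigma> d s) (post_var k \<sigma> d s + \<sigma>\<^sup>2).
        real (card (classified_set \<Omega> k \<sigma> \<beta> h \<epsilon> (Suc t) (d @ [(s, y)]))))"

text \<open>The pair \<open>(x, i)\<close> stands for requesting \<open>x\<close> with the \<open>i\<close>-th cost \<open>c i\<close>; the function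
  \<open>g (\<theta> x i)\<close> is the density of the point that is then evaluated.\<close>

definition acquisition ::
    "'a::euclidean_space set \<Rightarrow> 'a set \<Rightarrow> ('a \<Rightarrow> 'a \<Rightarrow> real) \<Rightarrow> real \<Rightarrow> real \<Rightarrow> real \<Rightarrow> real \<Rightarrow>
     (nat \<Rightarrow> real) \<Rightarrow> ('p \<Rightarrow> 'a \<Rightarrow> real) \<Rightarrow> ('a \<Rightarrow> nat \<Rightarrow> 'p) \<Rightarrow> nat \<Rightarrow> 'a data \<Rightarrow> 'a \<times> nat \<Rightarrow> real" where
  "acquisition D \<Omega> k \<sigma> \<beta> h \<epsilon> c g \<theta> t d = (\<lambda>(x, i).
     (1 / c i) *
       ((LINT s:D|lborel. expected_classified \<Omega> k \<sigma> \<beta> h \<epsilon> t d s * g (\<theta> x i) s)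
         - real (card (classified_set \<Omega> k \<sigma> \<beta> h \<epsilon> t d))))"

text \<open>A rule that selects a maximizer of the acquisition function from the current data, ties being
  broken in an arbitrary measurable way; \<open>n0\<close> is the number of initial training data.\<close>

definition acquisition_rule ::
    "'a::euclidean_space set \<Rightarrow> 'a set \<Rightarrow> ('a \<Rightarrow> 'a \<Rightarrow> real) \<Rightarrow> real \<Rightarrow> real \<Rightarrow> real \<Rightarrow> real \<Rightarrow>
     nat \<Rightarrow> (nat \<Rightarrow> real) \<Rightarrow> ('p \<Rightarrow> 'a \<Rightarrow> real) \<Rightarrow> ('a \<Rightarrow> nat \<Rightarrow> 'p) \<Rightarrow> nat \<Rightarrow>
     (nat \<Rightarrow> 'a data \<Rightarrow> 'a \<times> nat) \<Rightarrow> bool" where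
  "acquisition_rule D \<Omega> k \<sigma> \<beta> h \<epsilon> K c g \<theta> n0 pick \<longleftrightarrow>
     (\<forall>t. (\<lambda>z. pick t (map z [0..<n0 + t]))
            \<in> PiM {..<n0 + t} (\<lambda>_. borel) \<rightarrow>\<^sub>M count_space (\<Omega> \<times> {1..K})) \<and>
     (\<forall>t d. length d = n0 + t \<and> fst ` set d \<subseteq> D \<longrightarrow>
        is_arg_max (acquisition D \<Omega> k \<sigma> \<beta> h \<epsilon> c g \<theta> t d) (\<lambda>q. q \<in> \<Omega> \<times> {1..K}) (pick t d))"


section \<open>Runs of the algorithm\<close>

text \<open>Everything random is an independent input of a deterministic recursion: the function \<open>f\<close>, the
  points \<open>s0 j\<close> (\<open>j < n0\<close>) of the initial training data, and for each trial \<open>t \<ge> 1\<close> the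
  Bernoulli variable \<open>r t\<close>, the random candidate \<open>C t\<close>, and for each \<open>(x, i)\<close> the sample \<open>S t x i\<close>
  that is evaluated in case \<open>x\<close> is requested with the \<open>i\<close>-th cost. The noise \<open>\<rho> j\<close> belongs to
  the \<open>j\<close>-th observation, the initial ones coming first.\<close>

datatype source = Fun | Init | Bern nat | Cand nat | Input nat | Noise nat

definition sources :: "source set" where
  "sources = {Fun, Init} \<union> Bern ` {1..} \<union> Cand ` {1..} \<union> Input ` {1..} \<union> range Noise"

definition source_algebra ::
    "'w measure \<Rightarrow> 'a::euclidean_space set \<Rightarrow> 'a set \<Rightarrow> nat \<Rightarrow> ('a \<Rightarrow> 'w \<Rightarrow> real) \<Rightarrow>
     nat \<Rightarrow> (nat \<Rightarrow> 'w \<Rightarrow> 'a) \<Rightarrow> (nat \<Rightarrow> 'w \<Rightarrow> bool) \<Rightarrow> (nat \<Rightarrow> 'w \<Rightarrow> 'a \<times> nat) \<Rightarrow>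
     (nat \<Rightarrow> 'a \<Rightarrow> nat \<Rightarrow> 'w \<Rightarrow> 'a) \<Rightarrow> (nat \<Rightarrow> 'w \<Rightarrow> real) \<Rightarrow> source \<Rightarrow> 'w measure" where
  "source_algebra M D \<Omega> K f n0 s0 r C S \<rho> src = (case src of
       Fun \<Rightarrow> generated_by M D f borel
     | Init \<Rightarrow> generated_by M {..<n0} s0 borel
     | Bern t \<Rightarrow> generated_by M {t} r (count_space UNIV)
     | Cand t \<Rightarrow> generated_by M {t} C (count_space (\<Omega> \<times> {1..K}))
     | Input t \<Rightarrow> generated_by M (\<Omega> \<times> {1..K}) (\<lambda>(x, i). S t x i) borel
     | Noise j \<Rightarrow> generated_by M {j} \<rho> borel)"

definition independent_sources ::
    "'w measure \<Rightarrow> 'a::euclidean_space set \<Rightarrow> 'a set \<Rightarrow> nat \<Rightarrow> ('a \<Rightarrow> 'w \<Rightarrow> real) \<Rightarrow>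
     nat \<Rightarrow> (nat \<Rightarrow> 'w \<Rightarrow> 'a) \<Rightarrow> (nat \<Rightarrow> 'w \<Rightarrow> bool) \<Rightarrow> (nat \<Rightarrow> 'w \<Rightarrow> 'a \<times> nat) \<Rightarrow>
     (nat \<Rightarrow> 'a \<Rightarrow> nat \<Rightarrow> 'w \<Rightarrow> 'a) \<Rightarrow> (nat \<Rightarrow> 'w \<Rightarrow> real) \<Rightarrow> bool" where
  "independent_sources M D \<Omega> K f n0 s0 r C S \<rho> \<longleftrightarrow>
     prob_space.indep_sets M (\<lambda>src. sets (source_algebra M D \<Omega> K f n0 s0 r C S \<rho> src)) sources"

text \<open>The data after \<open>t\<close> trials. The recursion does not stop by itself: the trials after completion
  are never looked at.\<close>

fun run_data ::
    "('a \<Rightarrow> 'w \<Rightarrow> real) \<Rightarrow> nat \<Rightarrow> (nat \<Rightarrow> 'w \<Rightarrow> 'a) \<Rightarrow> (nat \<Rightarrow> 'w \<Rightarrow> bool) \<Rightarrow> (nat \<Rightarrow> 'w \<Rightarrow> 'a \<times> nat) \<Rightarrow>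
     (nat \<Rightarrow> 'a \<Rightarrow> nat \<Rightarrow> 'w \<Rightarrow> 'a) \<Rightarrow> (nat \<Rightarrow> 'w \<Rightarrow> real) \<Rightarrow> (nat \<Rightarrow> 'a data \<Rightarrow> 'a \<times> nat) \<Rightarrow>
     nat \<Rightarrow> 'w \<Rightarrow> 'a data" where
  "run_data f n0 s0 r C S \<rho> pick 0 \<omega> = map (\<lambda>j. (s0 j \<omega>, f (s0 j \<omega>) \<omega> + \<rho> j \<omega>)) [0..<n0]"
| "run_data f n0 s0 r C S \<rho> pick (Suc t) \<omega> =
     (let d = run_data f n0 s0 r C S \<rho> pick t \<omega>;
          (x, i) = (if r (Suc t) \<omega> then C (Suc t) \<omega> else pick t d);
          s = S (Suc t) x i \<omega>
      in d @ [(s, f s \<omega> + \<rho> (n0 + t) \<omega>)])"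

definition completes ::
    "'a set \<Rightarrow> ('a \<Rightarrow> 'a \<Rightarrow> real) \<Rightarrow> real \<Rightarrow> real \<Rightarrow> real \<Rightarrow> real \<Rightarrow> (nat \<Rightarrow> 'a data) \<Rightarrow> bool" where
  "completes \<Omega> k \<sigma> \<beta> h \<epsilon> d \<longleftrightarrow> (\<exists>t. unclassified_set \<Omega> k \<sigma> \<beta> h \<epsilon> t (d t) = {})"

definition completion_time ::
    "'a set \<Rightarrow> ('a \<Rightarrow> 'a \<Rightarrow> real) \<Rightarrow> real \<Rightarrow> real \<Rightarrow> real \<Rightarrow> real \<Rightarrow> (nat \<Rightarrow> 'a data) \<Rightarrow> nat" where
  "completion_time \<Omega> k \<sigma> \<beta> h \<epsilon> d = (LEAST t. unclassified_set \<Omega> k \<sigma> \<beta> h \<epsilon> t (d t) = {})"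

definition high_output ::
    "'a set \<Rightarrow> ('a \<Rightarrow> 'a \<Rightarrow> real) \<Rightarrow> real \<Rightarrow> real \<Rightarrow> real \<Rightarrow> real \<Rightarrow> (nat \<Rightarrow> 'a data) \<Rightarrow> 'a set" where
  "high_output \<Omega> k \<sigma> \<beta> h \<epsilon> d =
     (let T = completion_time \<Omega> k \<sigma> \<beta> h \<epsilon> d in high_set \<Omega> k \<sigma> \<beta> h \<epsilon> T (d T))"

definition low_output ::
    "'a set \<Rightarrow> ('a \<Rightarrow> 'a \<Rightarrow> real) \<Rightarrow> real \<Rightarrow> real \<Rightarrow> real \<Rightarrow> real \<Rightarrow> (nat \<Rightarrow> 'a data) \<Rightarrow> 'a set" where
  "low_output \<Omega> k \<sigma> \<beta> h \<epsilon> d =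
     (let T = completion_time \<Omega> k \<sigma> \<beta> h \<epsilon> d in low_set \<Omega> k \<sigma> \<beta> h \<epsilon> T (d T))"

text \<open>The two output sets may overlap; a point in both of them incurs the larger of the two
  losses.\<close>

definition misspec_loss :: "real \<Rightarrow> 'a set \<Rightarrow> 'a set \<Rightarrow> ('a \<Rightarrow> real) \<Rightarrow> 'a \<Rightarrow> real" where
  "misspec_loss h H L \<phi> x =
     (if x \<in> L \<and> x \<in> H then max (max 0 (\<phi> x - h)) (max 0 (h - \<phi> x))
      else if x \<in> L then max 0 (\<phi> x - h)
      else max 0 (h - \<phi> x))"

end

theory Submission
  imports Defs "Jordan_Normal_Form.Determinant"
begin

unbundle no vec_syntax

text \<open>Fix \<open>t\<close> and let \<open>y\<close> be the vector of observations made so far. Given the design randomness and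
  \<open>f\<close>, the vector \<open>y\<close> has density \<open>\<Prod>\<^sub>j \<phi>\<^sub>\<sigma>(y\<^sub>j - f(s\<^sub>j))\<close>, where \<open>s\<^sub>j\<close> depends only on the
  design randomness and on \<open>y\<^sub>1, \<dots>, y\<^sub>j\<^sub>-\<^sub>1\<close>. By Tonelli one may integrate over \<open>y\<close> last, and then the
  points are fixed when \<open>f\<close> is integrated out. For fixed points and values, the law of
  \<open>f(x)\<close> reweighted by this product is the posterior normal law, so that
  \<open>|f(x) - \<mu>\<^sub>t(x)| > \<beta>\<^sup>1\<^sup>/\<^sup>2 \<sigma>\<^sub>t(x)\<close> has posterior probability at most \<open>exp (-\<beta>/2) = \<delta>/|\<Omega>|\<close>.
  Summing over the disjoint events of completion at time \<open>t\<close>, and then over \<open>x \<in> \<Omega>\<close>, costs no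
  more than \<open>\<delta>\<close>.\<close>

text \<open>Two obstacles shape the proof. First, \<beta> does not grow with t although completion
  may come arbitrarily late, so a union bound over the misses at all times would diverge. The tail
  bound is therefore proved on any event decided by the data, with the probability of that event as
  a factor (\<open>posterior_tail_run\<close>). Second, the prior law of the values at the evaluated
  points may have no density: points may repeat and the kernel is only nonnegative definite. What
  the prior does give is the law of each linear combination. Hence the likelihood is written as a
  Fourier integral, in which f occurs only through linear combinations, and the posterior is
  recognised by its characteristic function. The measurability of k, and with it that of the
  posterior, is recovered from the joint measurability of f (\<open>kernel_conv_char\<close>). The
  logarithm in \<beta> carries no further factor 2 because the two-sided normal tail is bounded by
  exp(-\<beta>/2) itself.\<close>

section \<open>Normal laws\<close>

text \<open>On each half-line the cross term in the square of x + b is nonnegative, so moving a tail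
  to the origin costs the factor exp(-a^2/2). The two moved half-lines are disjoint and share mass
  1, so no factor 2 remains; \<beta> is calibrated to this bound.\<close>

lemma std_normal_two_sided_tail:
  assumes "0 \<le> a"
  shows "emeasure std_normal_distribution {x. a < \<bar>x\<bar>} \<le> ennreal (exp (- a\<^sup>2 / 2))"
proof -
  let ?\<phi> = "\<lambda>x. ennreal (std_normal_density x)"
  let ?e = "ennreal (exp (- a\<^sup>2 / 2))"
  have dens: "std_normal_density (x + b) \<le> exp (- a\<^sup>2 / 2) * std_normal_density x"
    if "\<bar>b\<bar> = a" "0 \<le> x * b" for x b
  proof -
    have "b\<^sup>2 = a\<^sup>2" using that(1) by auto
    then have "- (x + b)\<^sup>2 / 2 \<le> - a\<^sup>2 / 2 + - x\<^sup>2 / 2"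
      using that(2) by (simp add: power2_sum field_simps)
    then have "exp (- (x + b)\<^sup>2 / 2) \<le> exp (- a\<^sup>2 / 2) * exp (- x\<^sup>2 / 2)"
      by (simp flip: exp_add)
    then show ?thesis
      by (auto simp: std_normal_density_def intro!: divide_right_mono)
  qed
  have "emeasure std_normal_distribution {x. a < \<bar>x\<bar>}
      = (\<integral>\<^sup>+x. ?\<phi> x * indicator {x. a < \<bar>x\<bar>} x \<partial>lborel)"
    by (intro emeasure_density) auto
  also have "\<dots> = (\<integral>\<^sup>+x. ?\<phi> x * indicator {a<..} x + ?\<phi> x * indicator {..<-a} x \<partial>lborel)"
    using assms by (intro nn_integral_cong) (auto simp: indicator_def)
  also have "\<dots> = (\<integral>\<^sup>+x. ?\<phi> x * indicator {a<..} x \<partial>lborel) + (\<integral>\<^sup>+x. ?\<phi> x * indicator {..<-a} x \<partial>lborel)"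
    by (intro nn_integral_add) auto
  also have "(\<integral>\<^sup>+x. ?\<phi> x * indicator {a<..} x \<partial>lborel)
      = (\<integral>\<^sup>+x. ?\<phi> (x + a) * indicator {0<..} x \<partial>lborel)"
    by (subst nn_integral_real_affine[where c=1 and t=a])
       (auto intro!: nn_integral_cong simp: indicator_def add.commute)
  also have "(\<integral>\<^sup>+x. ?\<phi> x * indicator {..<-a} x \<partial>lborel)
      = (\<integral>\<^sup>+x. ?\<phi> (x + - a) * indicator {..<0} x \<partial>lborel)"
    by (subst nn_integral_real_affine[where c=1 and t="-a"])
       (auto intro!: nn_integral_cong simp: indicator_def add.commute)
  also have "(\<integral>\<^sup>+x. ?\<phi> (x + a) * indicator {0<..} x \<partial>lborel)
      \<le> (\<integral>\<^sup>+x. ?e * (?\<phi> x * indicator {0<..} x) \<partial>lborel)"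
    using assms dens[of a]
    by (intro nn_integral_mono) (auto simp: indicator_def simp flip: ennreal_mult intro!: ennreal_leI)
  also have "(\<integral>\<^sup>+x. ?\<phi> (x + - a) * indicator {..<0} x \<partial>lborel)
      \<le> (\<integral>\<^sup>+x. ?e * (?\<phi> x * indicator {..<0} x) \<partial>lborel)"
    using assms dens[of "-a"]
    by (intro nn_integral_mono)
       (auto simp: indicator_def mult_nonpos_nonneg simp flip: ennreal_mult intro!: ennreal_leI)
  also have "(\<integral>\<^sup>+x. ?e * (?\<phi> x * indicator {0<..} x) \<partial>lborel)
        + (\<integral>\<^sup>+x. ?e * (?\<phi> x * indicator {..<0} x) \<partial>lborel)
      = (\<integral>\<^sup>+x. ?e * (?\<phi> x * indicator {0<..} x) + ?e * (?\<phi> x * indicator {..<0} x) \<partial>lborel)"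
    by (intro nn_integral_add[symmetric]) auto
  also have "\<dots> \<le> (\<integral>\<^sup>+x. ?e * ?\<phi> x \<partial>lborel)"
    by (intro nn_integral_mono) (auto simp: indicator_def)
  also have "\<dots> = ?e * (\<integral>\<^sup>+x. ?\<phi> x \<partial>lborel)"
    by (intro nn_integral_cmult) auto
  also have "(\<integral>\<^sup>+x. ?\<phi> x \<partial>lborel) = 1"
    using prob_space.emeasure_space_1[OF prob_space_normal_density[of 1 0]]
    by (simp add: emeasure_density)
  finally show ?thesis by (simp add: add_mono)
qed

lemma integral_iexp_std_normal:
  "(CLINT x|lborel. std_normal_density x * iexp (t * x)) = complex_of_real (exp (- t\<^sup>2 / 2))"
  using fun_cong[OF char_std_normal_distribution, of t]
  by (simp add: char_def integral_density scaleR_conv_of_real)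

lemma char_normal_law:
  assumes "0 \<le> v"
  shows "char (normal_law 0 v) t = complex_of_real (exp (- v * t\<^sup>2 / 2))"
proof (cases "v = 0")
  case False
  then have v: "0 < v" using assms by simp
  have "char (normal_law 0 v) t = (CLINT x|lborel. normal_density 0 (sqrt v) x * iexp (t * x))"
    using False by (simp add: char_def normal_law_def integral_density normal_density_nonneg scaleR_conv_of_real)
  also have "\<dots> = \<bar>sqrt v\<bar> *\<^sub>R (CLINT x|lborel. normal_density 0 (sqrt v) (0 + sqrt v * x) * iexp (t * (0 + sqrt v * x)))"
    using v by (intro lborel_integral_real_affine) auto
  also have "\<dots> = (CLINT x|lborel. \<bar>sqrt v\<bar> *\<^sub>R (normal_density 0 (sqrt v) (0 + sqrt v * x) * iexp (t * (0 + sqrt v * x))))"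
    by (intro integral_scaleR_right[symmetric])
  also have "\<dots> = (CLINT x|lborel. std_normal_density x * iexp ((t * sqrt v) * x))"
    using v by (intro Bochner_Integration.integral_cong)
      (auto simp: normal_density_def real_sqrt_mult power_mult_distrib scaleR_conv_of_real field_simps)
  finally show ?thesis
    using v by (simp only: integral_iexp_std_normal) (simp add: power_mult_distrib field_simps)
qed (simp add: char_def normal_law_def integral_return)

text \<open>Up to normalisation a Gaussian is its own Fourier transform: the characteristic function
  of variance 1/\<sigma>^2 at y - m is exp(-(y-m)^2/(2\<sigma>^2)). In this form m sits linearly in
  an exponent, so products of such densities become exponentials of linear combinations of the
  means.\<close>

lemma fourier_normal_density:
  assumes "0 < \<sigma>"
  shows "complex_of_real (normal_density m \<sigma> y)
    = (CLINT u|lborel. (normal_density 0 (1 / \<sigma>) u / (sqrt (2 * pi) * \<sigma>)) * iexp (u * (y - m)))"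
proof -
  have "(CLINT u|lborel. (normal_density 0 (1 / \<sigma>) u / (sqrt (2 * pi) * \<sigma>)) * iexp (u * (y - m)))
     = (CLINT u|lborel. (1 / (sqrt (2 * pi) * \<sigma>)) * (normal_density 0 (1 / \<sigma>) u * iexp ((y - m) * u)))"
    by (intro Bochner_Integration.integral_cong) (auto simp: field_simps)
  also have "\<dots> = complex_of_real (1 / (sqrt (2 * pi) * \<sigma>)) * (CLINT u|lborel. normal_density 0 (1 / \<sigma>) u * iexp ((y - m) * u))"
    by (simp only: of_real_mult[symmetric] integral_mult_right_zero)
  also have "(CLINT u|lborel. normal_density 0 (1 / \<sigma>) u * iexp ((y - m) * u)) = char (normal_law 0 ((1/\<sigma>)\<^sup>2)) (y - m)"
    using assms by (simp add: char_def normal_law_def integral_density normal_density_nonneg scaleR_conv_of_real)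
  also have "\<dots> = complex_of_real (exp (- (y - m)\<^sup>2 / (2 * \<sigma>\<^sup>2)))"
    using assms by (subst char_normal_law) (auto simp: field_simps)
  finally show ?thesis
    using assms by (simp add: normal_density_def real_sqrt_mult)
qed

lemma prob_space_normal_law: "0 \<le> v \<Longrightarrow> prob_space (normal_law m v)"
  unfolding normal_law_def by (auto intro!: prob_space_return prob_space_normal_density)

lemma sets_normal_law [measurable_cong, simp]: "sets (normal_law m v) = sets borel"
  by (simp add: normal_law_def)

lemma real_distribution_normal_law: "0 \<le> v \<Longrightarrow> real_distribution (normal_law m v)"
  by (simp add: real_distribution_def real_distribution_axioms_def prob_space_normal_law)

text \<open>For v > 0 the law is a scaled standard normal, the two being matched by their
  characteristic functions; for v = 0 the strict inequality excludes the point mass at 0.\<close>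

lemma normal_law_two_sided_tail:
  assumes "0 \<le> v" "0 \<le> \<beta>"
  shows "emeasure (normal_law 0 v) {z. sqrt \<beta> * sqrt v < \<bar>z\<bar>} \<le> ennreal (exp (- \<beta> / 2))"
proof (cases "v = 0")
  case False
  then have v: "0 < v" using assms by simp
  interpret N: real_distribution std_normal_distribution by (rule real_dist_normal_dist)
  have "normal_law 0 v = distr std_normal_distribution borel (\<lambda>z. sqrt v * z)"
  proof (rule Levy_uniqueness)
    show "real_distribution (distr std_normal_distribution borel (\<lambda>z. sqrt v * z))"
      by (intro N.real_distribution_distr) simp
    show "char (normal_law 0 v) = char (distr std_normal_distribution borel (\<lambda>z. sqrt v * z))"
    proof
      fix t
      have "char (distr std_normal_distribution borel (\<lambda>z. sqrt v * z)) t
          = char std_normal_distribution (t * sqrt v)"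
        by (simp add: char_def integral_distr mult.assoc)
      also have "\<dots> = char (normal_law 0 v) t"
        using v by (simp only: char_std_normal_distribution char_normal_law[OF assms(1)])
          (simp add: power_mult_distrib mult.commute)
      finally show "char (normal_law 0 v) t = char (distr std_normal_distribution borel (\<lambda>z. sqrt v * z)) t"
        by simp
    qed
  qed (use real_distribution_normal_law[OF assms(1)] in auto)
  then have "emeasure (normal_law 0 v) {z. sqrt \<beta> * sqrt v < \<bar>z\<bar>}
      = emeasure std_normal_distribution ((\<lambda>z. sqrt v * z) -` {z. sqrt \<beta> * sqrt v < \<bar>z\<bar>} \<inter> space std_normal_distribution)"
    by (simp add: emeasure_distr)
  also have "(\<lambda>z. sqrt v * z) -` {z. sqrt \<beta> * sqrt v < \<bar>z\<bar>} \<inter> space std_normal_distribution = {z. sqrt \<beta> < \<bar>z\<bar>}"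
    using v by (auto simp: abs_mult mult.commute)
  also have "emeasure std_normal_distribution \<dots> \<le> ennreal (exp (- (sqrt \<beta>)\<^sup>2 / 2))"
    using assms by (intro std_normal_two_sided_tail) auto
  finally show ?thesis using assms by simp
qed (simp add: normal_law_def)

text \<open>A rectangle pulls back to a rectangle with each side translated, so one-dimensional
  invariance suffices. The translation is restricted to I because points of the product space are
  extensional functions.\<close>

lemma distr_PiM_lborel_translate:
  fixes b :: "'i \<Rightarrow> real"
  assumes "finite I"
  shows "distr (PiM I (\<lambda>_. lborel)) (PiM I (\<lambda>_. lborel)) (\<lambda>u. \<lambda>j\<in>I. u j + b j) = PiM I (\<lambda>_. lborel)"
proof -
  interpret product_sigma_finite "\<lambda>_::'i. lborel :: real measure" by unfold_locales
  let ?T = "\<lambda>u. \<lambda>j\<in>I. u j + b j"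
  have [measurable]: "?T \<in> PiM I (\<lambda>_. lborel) \<rightarrow>\<^sub>M PiM I (\<lambda>_. lborel)"
    by measurable
  show ?thesis
  proof (rule PiM_eqI)
    fix A :: "'i \<Rightarrow> real set" assume A: "\<And>i. i \<in> I \<Longrightarrow> A i \<in> sets lborel"
    have B: "(\<lambda>x. x + b i) -` A i \<in> sets borel" if "i \<in> I" for i
      using measurable_sets[of "\<lambda>x. x + b i" borel borel "A i"] A[OF that] by simp
    have "emeasure (distr (PiM I (\<lambda>_. lborel)) (PiM I (\<lambda>_. lborel)) ?T) (Pi\<^sub>E I A)
        = emeasure (PiM I (\<lambda>_. lborel)) (?T -` (Pi\<^sub>E I A) \<inter> space (PiM I (\<lambda>_. lborel)))"
      using A assms by (intro emeasure_distr) (auto intro!: sets_PiM_I_finite)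
    also have "?T -` (Pi\<^sub>E I A) \<inter> space (PiM I (\<lambda>_. lborel)) = (\<Pi>\<^sub>E i\<in>I. (\<lambda>x. x + b i) -` A i)"
      by (auto simp: space_PiM PiE_iff)
    also have "emeasure (PiM I (\<lambda>_. lborel)) \<dots> = (\<Prod>i\<in>I. emeasure lborel ((\<lambda>x. x + b i) -` A i))"
      using B assms by (intro emeasure_PiM) auto
    also have "\<dots> = (\<Prod>i\<in>I. emeasure lborel (A i))"
    proof (rule prod.cong)
      fix i assume i: "i \<in> I"
      have "emeasure lborel (A i) = emeasure (distr lborel borel ((+) (b i))) (A i)"
        by (simp add: lborel_distr_plus)
      also have "\<dots> = emeasure lborel ((\<lambda>x. x + b i) -` A i)"
        using A[OF i] by (subst emeasure_distr) (auto simp: vimage_def add.commute)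
      finally show "emeasure lborel ((\<lambda>x. x + b i) -` A i) = emeasure lborel (A i)" by simp
    qed simp
    finally show "emeasure (distr (PiM I (\<lambda>_. lborel)) (PiM I (\<lambda>_. lborel)) ?T) (Pi\<^sub>E I A)
        = (\<Prod>i\<in>I. emeasure lborel (A i))" .
  qed (use assms in auto)
qed

section \<open>Gaussian process priors\<close>

text \<open>A run may evaluate the same point several times, while the prior speaks of finite sets
  of distinct points; gathering the coefficients of equal points passes from indexed families to
  sets.\<close>

lemma sum_regroup_image:
  fixes a :: "'i \<Rightarrow> real"
  assumes "finite I"
  shows "(\<Sum>i\<in>I. a i * g (s i)) = (\<Sum>x\<in>s ` I. (\<Sum>i | i \<in> I \<and> s i = x. a i) * g x)"
proof -
  have "(\<Sum>i\<in>I. a i * g (s i)) = (\<Sum>x\<in>s ` I. \<Sum>i | i \<in> I \<and> s i = x. a i * g (s i))"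
    by (rule sum.image_gen[OF assms])
  also have "\<dots> = (\<Sum>x\<in>s ` I. (\<Sum>i | i \<in> I \<and> s i = x. a i) * g x)"
    by (intro sum.cong) (auto simp: sum_distrib_right)
  finally show ?thesis .
qed

lemma quadratic_form_regroup_image:
  fixes a :: "'i \<Rightarrow> real" and s :: "'i \<Rightarrow> 'a"
  assumes "finite I"
  defines "A \<equiv> \<lambda>x. \<Sum>i | i \<in> I \<and> s i = x. a i"
  shows "(\<Sum>i\<in>I. \<Sum>j\<in>I. a i * a j * k (s i) (s j)) = (\<Sum>x\<in>s ` I. \<Sum>x'\<in>s ` I. A x * A x' * k x x')"
proof -
  have "(\<Sum>i\<in>I. \<Sum>j\<in>I. a i * a j * k (s i) (s j)) = (\<Sum>i\<in>I. a i * (\<Sum>j\<in>I. a j * k (s i) (s j)))"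
    by (simp add: sum_distrib_left mult.assoc)
  also have "\<dots> = (\<Sum>i\<in>I. a i * (\<Sum>x'\<in>s ` I. A x' * k (s i) x'))"
    unfolding A_def by (subst sum_regroup_image[OF assms(1)]) simp
  also have "\<dots> = (\<Sum>x\<in>s ` I. A x * (\<Sum>x'\<in>s ` I. A x' * k x x'))"
    unfolding A_def by (rule sum_regroup_image[OF assms(1), of a "\<lambda>z. \<Sum>x'\<in>s ` I. (\<Sum>i | i \<in> I \<and> s i = x'. a i) * k z x'"])
  finally show ?thesis by (simp add: sum_distrib_left mult.assoc)
qed

lemma pos_def_kernel_family_nonneg:
  assumes "pos_def_kernel D k" "finite I" "s ` I \<subseteq> D"
  shows "0 \<le> (\<Sum>i\<in>I. \<Sum>j\<in>I. a i * a j * k (s i) (s j))"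
  using assms by (subst quadratic_form_regroup_image) (auto simp: pos_def_kernel_def)

locale gp_prior = prob_space M
  for M :: "'w measure" +
  fixes D :: "'a::euclidean_space set" and k :: "'a \<Rightarrow> 'a \<Rightarrow> real" and f :: "'a \<Rightarrow> 'w \<Rightarrow> real"
  assumes kernel: "pos_def_kernel D k"
    and prior: "gaussian_process M D k f"
begin

lemma kernel_sym: "x \<in> D \<Longrightarrow> x' \<in> D \<Longrightarrow> k x x' = k x' x"
  using kernel by (auto simp: pos_def_kernel_def)

lemma rv_f: "x \<in> D \<Longrightarrow> f x \<in> borel_measurable M"
  using prior by (auto simp: gaussian_process_def)

text \<open>Regrouping turns the indexed sum into one over distinct points, whose law the prior
  prescribes. The frequency is absorbed into the coefficients, hence the evaluation of
  \<open>char\<close> at 1.\<close>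

lemma char_linear_combination:
  assumes "finite I" "s ` I \<subseteq> D"
  shows "(CLINT \<omega>|M. iexp (\<Sum>i\<in>I. a i * f (s i) \<omega>))
    = complex_of_real (exp (- (\<Sum>i\<in>I. \<Sum>j\<in>I. a i * a j * k (s i) (s j)) / 2))"
proof -
  define A where "A = (\<lambda>x. \<Sum>i | i \<in> I \<and> s i = x. a i)"
  define v where "v = (\<Sum>i\<in>I. \<Sum>j\<in>I. a i * a j * k (s i) (s j))"
  have v0: "0 \<le> v"
    unfolding v_def by (rule pos_def_kernel_family_nonneg[OF kernel assms])
  have [measurable]: "f x \<in> borel_measurable M" if "x \<in> s ` I" for x
    using rv_f assms that by auto
  have "distr M borel (\<lambda>\<omega>. \<Sum>x\<in>s ` I. A x * f x \<omega>)
      = normal_law 0 (\<Sum>x\<in>s ` I. \<Sum>x'\<in>s ` I. A x * A x' * k x x')"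
    using prior assms by (auto simp: gaussian_process_def)
  also have "(\<Sum>x\<in>s ` I. \<Sum>x'\<in>s ` I. A x * A x' * k x x') = v"
    unfolding v_def A_def by (rule quadratic_form_regroup_image[OF assms(1), symmetric])
  finally have law: "distr M borel (\<lambda>\<omega>. \<Sum>x\<in>s ` I. A x * f x \<omega>) = normal_law 0 v" .
  have "(CLINT \<omega>|M. iexp (\<Sum>i\<in>I. a i * f (s i) \<omega>)) = (CLINT \<omega>|M. iexp (1 * (\<Sum>x\<in>s ` I. A x * f x \<omega>)))"
    unfolding A_def mult_1 using sum_regroup_image[OF assms(1), of a "\<lambda>x. f x _" s] by simp
  also have "\<dots> = char (distr M borel (\<lambda>\<omega>. \<Sum>x\<in>s ` I. A x * f x \<omega>)) 1"
    unfolding char_def by (rule integral_distr[symmetric]) auto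
  also have "\<dots> = complex_of_real (exp (- v / 2))"
    unfolding law char_normal_law[OF v0] by simp
  finally show ?thesis unfolding v_def .
qed

section \<open>Fourier form of the prior reweighted by a likelihood\<close>

context
  fixes n :: nat and s :: "nat \<Rightarrow> 'a" and x :: 'a and y \<alpha> :: "nat \<Rightarrow> real" and \<sigma> :: real
  assumes s: "\<And>j. j < n \<Longrightarrow> s j \<in> D" and x: "x \<in> D" and \<sigma>: "0 < \<sigma>"
    and \<alpha>: "\<And>i. i < n \<Longrightarrow> (\<Sum>j<n. k (s i) (s j) * \<alpha> j) + \<sigma>\<^sup>2 * \<alpha> i = k (s i) x"
begin

text \<open>The variance of l f(x) minus the sum of the u_j f(s_j).\<close>

definition joint_var :: "real \<Rightarrow> (nat \<Rightarrow> real) \<Rightarrow> real" where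
  "joint_var l u = l\<^sup>2 * k x x - 2 * l * (\<Sum>j<n. u j * k (s j) x) + (\<Sum>i<n. \<Sum>j<n. u i * u j * k (s i) (s j))"

definition fourier_weight :: "real \<Rightarrow> real" where
  "fourier_weight u = normal_density 0 (1 / \<sigma>) u / (sqrt (2 * pi) * \<sigma>)"

text \<open>What remains of exp(i l f(x)) times the likelihood once each factor of the likelihood is
  a Fourier integral in its own frequency u_j and f has been averaged out.\<close>

definition fourier_integrand :: "real \<Rightarrow> (nat \<Rightarrow> real) \<Rightarrow> complex" where
  "fourier_integrand l u =
     (\<Prod>j<n. complex_of_real (fourier_weight (u j)) * iexp (u j * y j)) * complex_of_real (exp (- joint_var l u / 2))"

lemma char_joint:
  "(CLINT \<omega>|M. iexp (l * f x \<omega> - (\<Sum>j<n. u j * f (s j) \<omega>))) = complex_of_real (exp (- joint_var l u / 2))"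
proof -
  \<comment> \<open>The point x is appended with index n and coefficient l; the evaluated points
    keep their indices, with coefficients - u j.\<close>
  let ?a = "(\<lambda>j. - u j)(n := l)" and ?s = "s(n := x)"
  have char: "(CLINT \<omega>|M. iexp (\<Sum>i\<in>{..<Suc n}. ?a i * f (?s i) \<omega>))
      = complex_of_real (exp (- (\<Sum>i\<in>{..<Suc n}. \<Sum>j\<in>{..<Suc n}. ?a i * ?a j * k (?s i) (?s j)) / 2))"
    using s x by (intro char_linear_combination) (auto simp: less_Suc_eq)
  have lin: "(\<Sum>i\<in>{..<Suc n}. ?a i * f (?s i) \<omega>) = l * f x \<omega> - (\<Sum>j<n. u j * f (s j) \<omega>)" for \<omega>
    by (simp add: sum_negf)
  have var: "(\<Sum>i\<in>{..<Suc n}. \<Sum>j\<in>{..<Suc n}. ?a i * ?a j * k (?s i) (?s j)) = joint_var l u"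
  proof -
    have "(\<Sum>j<n. l * u j * k x (s j)) = l * (\<Sum>j<n. u j * k (s j) x)"
      unfolding sum_distrib_left by (intro sum.cong) (use s x kernel_sym in auto)
    moreover have "(\<Sum>j<n. u j * l * k (s j) x) = l * (\<Sum>j<n. u j * k (s j) x)"
      unfolding sum_distrib_left by (intro sum.cong) auto
    ultimately show ?thesis
      by (simp add: joint_var_def sum.distrib sum_negf sum_subtractf power2_eq_square)
  qed
  show ?thesis using char unfolding lin var .
qed

text \<open>Completing the square. The linear system for \<alpha> replaces K \<alpha> by k(x) -
  \<sigma>^2 \<alpha>, which cancels the mixed terms l u_j k(s_j, x). The \<sigma>^2 terms left over
  are those by which the Fourier weights change under the same translation, and the surviving
  coefficient of l^2 is the posterior variance.\<close>

lemma joint_var_shift: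
  "joint_var l (\<lambda>j. u j + l * \<alpha> j) + \<sigma>\<^sup>2 * (\<Sum>j<n. 2 * l * u j * \<alpha> j + l\<^sup>2 * (\<alpha> j)\<^sup>2)
     = joint_var 0 u + l\<^sup>2 * (k x x - (\<Sum>j<n. \<alpha> j * k (s j) x))"
proof -
  have K\<alpha>: "(\<Sum>i<n. \<Sum>j<n. b i * \<alpha> j * k (s i) (s j)) = (\<Sum>i<n. b i * k (s i) x) - \<sigma>\<^sup>2 * (\<Sum>i<n. b i * \<alpha> i)"
    for b :: "nat \<Rightarrow> real"
  proof -
    have "(\<Sum>i<n. \<Sum>j<n. b i * \<alpha> j * k (s i) (s j)) = (\<Sum>i<n. b i * (\<Sum>j<n. k (s i) (s j) * \<alpha> j))"
      by (simp add: sum_distrib_left mult_ac)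
    also have "\<dots> = (\<Sum>i<n. b i * (k (s i) x - \<sigma>\<^sup>2 * \<alpha> i))"
      by (intro sum.cong refl arg_cong2[where f="(*)"]) (use \<alpha> in \<open>auto simp: algebra_simps\<close>)
    finally show ?thesis by (simp add: algebra_simps sum_subtractf sum_distrib_left)
  qed
  have swap: "(\<Sum>i<n. \<Sum>j<n. \<alpha> i * u j * k (s i) (s j)) = (\<Sum>i<n. \<Sum>j<n. u i * \<alpha> j * k (s i) (s j))"
    by (subst sum.swap) (intro sum.cong refl, use s kernel_sym in auto)
  have "(\<Sum>i<n. \<Sum>j<n. (u i + l * \<alpha> i) * (u j + l * \<alpha> j) * k (s i) (s j))
      = (\<Sum>i<n. \<Sum>j<n. u i * u j * k (s i) (s j)) + l * (\<Sum>i<n. \<Sum>j<n. u i * \<alpha> j * k (s i) (s j))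
        + l * (\<Sum>i<n. \<Sum>j<n. \<alpha> i * u j * k (s i) (s j)) + l\<^sup>2 * (\<Sum>i<n. \<Sum>j<n. \<alpha> i * \<alpha> j * k (s i) (s j))"
    by (simp add: sum_distrib_left sum.distrib[symmetric] algebra_simps power2_eq_square)
  then show ?thesis
    unfolding joint_var_def swap K\<alpha>
    by (simp add: sum_distrib_left sum.distrib algebra_simps power2_eq_square)
qed

lemma fourier_weight_shift:
  "fourier_weight (u + b) = fourier_weight u * exp (- \<sigma>\<^sup>2 * (2 * u * b + b\<^sup>2) / 2)"
  using \<sigma> by (simp add: fourier_weight_def normal_density_def power_divide algebra_simps power2_sum
      add_divide_distrib diff_divide_distrib flip: exp_add)

text \<open>The exponentials coming from the weights combine with \<open>joint_var_shift\<close>, so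
  the translated integrand is the one for l = 0 times a factor free of u. That factor is the
  characteristic function of the posterior: its phase carries the mean, its modulus the
  variance.\<close>

lemma fourier_integrand_shift:
  "fourier_integrand l (\<lambda>j. u j + l * \<alpha> j)
     = iexp (l * (\<Sum>j<n. \<alpha> j * y j)) * complex_of_real (exp (- l\<^sup>2 * (k x x - (\<Sum>j<n. \<alpha> j * k (s j) x)) / 2))
       * fourier_integrand 0 u"
proof -
  let ?E = "\<lambda>j. exp (- \<sigma>\<^sup>2 * (2 * l * u j * \<alpha> j + l\<^sup>2 * (\<alpha> j)\<^sup>2) / 2)"
  have "(\<Prod>j<n. complex_of_real (fourier_weight (u j + l * \<alpha> j)) * iexp ((u j + l * \<alpha> j) * y j))
     = (\<Prod>j<n. (complex_of_real (fourier_weight (u j)) * iexp (u j * y j)) * (complex_of_real (?E j) * iexp (l * (\<alpha> j * y j))))"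
    by (intro prod.cong refl)
      (simp add: fourier_weight_shift power_mult_distrib ring_distribs exp_add mult_ac)
  also have "\<dots> = (\<Prod>j<n. complex_of_real (fourier_weight (u j)) * iexp (u j * y j))
      * ((\<Prod>j<n. complex_of_real (?E j)) * (\<Prod>j<n. iexp (l * (\<alpha> j * y j))))"
    by (simp only: prod.distrib)
  also have "(\<Prod>j<n. complex_of_real (?E j))
      = complex_of_real (exp (- \<sigma>\<^sup>2 * (\<Sum>j<n. 2 * l * u j * \<alpha> j + l\<^sup>2 * (\<alpha> j)\<^sup>2) / 2))"
    by (simp only: of_real_prod[symmetric] exp_sum[symmetric] finite_lessThan)
       (simp only: sum_divide_distrib[symmetric] sum_distrib_left[symmetric])
  also have "(\<Prod>j<n. iexp (l * (\<alpha> j * y j))) = iexp (l * (\<Sum>j<n. \<alpha> j * y j))"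
    by (simp only: exp_sum[symmetric] finite_lessThan)
       (simp only: sum_distrib_left[symmetric] of_real_sum[symmetric])
  finally have P: "(\<Prod>j<n. complex_of_real (fourier_weight (u j + l * \<alpha> j)) * iexp ((u j + l * \<alpha> j) * y j))
     = (\<Prod>j<n. complex_of_real (fourier_weight (u j)) * iexp (u j * y j))
      * (complex_of_real (exp (- \<sigma>\<^sup>2 * (\<Sum>j<n. 2 * l * u j * \<alpha> j + l\<^sup>2 * (\<alpha> j)\<^sup>2) / 2))
         * iexp (l * (\<Sum>j<n. \<alpha> j * y j)))" .
  have half: "- a * X / 2 + - J / 2 = - (J + a * X) / 2" for a X J :: real
    by (simp add: field_simps)
  have "exp (- \<sigma>\<^sup>2 * (\<Sum>j<n. 2 * l * u j * \<alpha> j + l\<^sup>2 * (\<alpha> j)\<^sup>2) / 2)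
        * exp (- joint_var l (\<lambda>j. u j + l * \<alpha> j) / 2)
      = exp (- (joint_var l (\<lambda>j. u j + l * \<alpha> j) + \<sigma>\<^sup>2 * (\<Sum>j<n. 2 * l * u j * \<alpha> j + l\<^sup>2 * (\<alpha> j)\<^sup>2)) / 2)"
    unfolding exp_add[symmetric] half ..
  also have "\<dots> = exp (- l\<^sup>2 * (k x x - (\<Sum>j<n. \<alpha> j * k (s j) x)) / 2) * exp (- joint_var 0 u / 2)"
    unfolding joint_var_shift exp_add[symmetric] half ..
  finally have E: "complex_of_real (exp (- \<sigma>\<^sup>2 * (\<Sum>j<n. 2 * l * u j * \<alpha> j + l\<^sup>2 * (\<alpha> j)\<^sup>2) / 2))
        * complex_of_real (exp (- joint_var l (\<lambda>j. u j + l * \<alpha> j) / 2))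
      = complex_of_real (exp (- l\<^sup>2 * (k x x - (\<Sum>j<n. \<alpha> j * k (s j) x)) / 2)) * complex_of_real (exp (- joint_var 0 u / 2))"
    unfolding of_real_mult[symmetric] by simp
  show ?thesis
    unfolding fourier_integrand_def P using E by (simp only: mult_ac)
qed

lemma fourier_integrand_cong: "(\<And>j. j < n \<Longrightarrow> u j = u' j) \<Longrightarrow> fourier_integrand l u = fourier_integrand l u'"
  by (simp add: fourier_integrand_def joint_var_def)

lemma measurable_fourier_weight [measurable]: "fourier_weight \<in> borel_measurable borel"
  unfolding fourier_weight_def by measurable

lemma measurable_fourier_integrand [measurable]:
  "fourier_integrand l \<in> borel_measurable (PiM {..<n} (\<lambda>_. lborel))"
proof -
  have [measurable]: "(\<lambda>u. u j) \<in> borel_measurable (PiM {..<n} (\<lambda>_. lborel))" if "j < n" for j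
    using measurable_component_singleton[of j "{..<n}" "\<lambda>_. lborel :: real measure"] that by simp
  show ?thesis
    unfolding fourier_integrand_def joint_var_def
    by (intro borel_measurable_times borel_measurable_prod borel_measurable_of_real
        borel_measurable_exp borel_measurable_divide borel_measurable_add borel_measurable_diff
        borel_measurable_uminus borel_measurable_sum borel_measurable_const borel_measurable_const
        measurable_compose[OF _ measurable_fourier_weight]) auto
qed

lemma fourier_weight_nonneg: "0 \<le> fourier_weight u"
  using \<sigma> by (simp add: fourier_weight_def normal_density_nonneg)

lemma integrable_fourier_weight: "integrable lborel fourier_weight"
  unfolding fourier_weight_def using \<sigma> by (intro integrable_divide_zero) (auto intro!: integrable_normal_density)

text \<open>Each likelihood factor is replaced by its Fourier integral and the expectation over f is
  moved inside, where it is the characteristic function of a linear combination.\<close>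

lemma char_weighted_eq_integral:
  "(CLINT \<omega>|M. iexp (l * f x \<omega>) * complex_of_real (\<Prod>j<n. normal_density (f (s j) \<omega>) \<sigma> (y j)))
     = (CLINT u|PiM {..<n} (\<lambda>_. lborel). fourier_integrand l u)"
proof -
  let ?\<Lambda> = "PiM {..<n} (\<lambda>_. lborel :: real measure)"
  interpret P: product_sigma_finite "\<lambda>_::nat. lborel :: real measure" by unfold_locales
  interpret F: finite_product_sigma_finite "\<lambda>_::nat. lborel :: real measure" "{..<n}" by unfold_locales simp
  interpret Q: pair_sigma_finite M ?\<Lambda> by unfold_locales
  have [measurable]: "f x \<in> borel_measurable M" by (rule rv_f[OF x])
  have fs[measurable]: "j < n \<Longrightarrow> f (s j) \<in> borel_measurable M" for j by (rule rv_f[OF s])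
  let ?h = "\<lambda>\<omega> u. iexp (l * f x \<omega>) *
      (\<Prod>j<n. complex_of_real (fourier_weight (u j)) * iexp (u j * (y j - f (s j) \<omega>)))"
  have int1: "complex_integrable lborel (\<lambda>u. complex_of_real (fourier_weight u) * iexp (u * b))" for b
    by (rule Bochner_Integration.integrable_bound[OF integrable_fourier_weight])
       (auto simp: norm_mult fourier_weight_nonneg)
  have intw: "integrable ?\<Lambda> (\<lambda>u. \<Prod>j<n. fourier_weight (u j))"
    by (intro P.product_integrable_prod integrable_fourier_weight) simp
  \<comment> \<open>The exponentials have modulus 1, so the norm is integrable in u and free of
    \<omega>; on a probability space this is what Fubini needs.\<close>
  have norm_h: "norm (?h \<omega> u) = (\<Prod>j<n. fourier_weight (u j))" for \<omega> u
    by (simp add: norm_mult prod_norm[symmetric] fourier_weight_nonneg)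
  have [measurable]: "(\<lambda>u. u j) \<in> borel_measurable ?\<Lambda>" if "j < n" for j
    using measurable_component_singleton[of j "{..<n}" "\<lambda>_. lborel :: real measure"] that by simp
  have meas: "case_prod ?h \<in> borel_measurable (M \<Otimes>\<^sub>M ?\<Lambda>)"
  proof -
    have "(\<lambda>p. complex_of_real (fourier_weight (snd p j)) * iexp (snd p j * (y j - f (s j) (fst p))))
        \<in> borel_measurable (M \<Otimes>\<^sub>M ?\<Lambda>)" if "j < n" for j
    proof -
      have [measurable]: "(\<lambda>p. snd p j) \<in> borel_measurable (M \<Otimes>\<^sub>M ?\<Lambda>)" 
        "(\<lambda>p. f (s j) (fst p)) \<in> borel_measurable (M \<Otimes>\<^sub>M ?\<Lambda>)"
        using that by (auto intro: measurable_compose[OF measurable_snd] measurable_compose[OF measurable_fst])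
      show ?thesis by measurable
    qed
    then show ?thesis
      unfolding case_prod_beta by (intro borel_measurable_times borel_measurable_prod) auto
  qed
  have int: "integrable (M \<Otimes>\<^sub>M ?\<Lambda>) (case_prod ?h)"
  proof (rule Q.Fubini_integrable[OF meas])
    show "integrable M (\<lambda>\<omega>. LINT u|?\<Lambda>. norm (case_prod ?h (\<omega>, u)))"
      unfolding prod.case norm_h by simp
    show "AE \<omega> in M. integrable ?\<Lambda> (\<lambda>u. case_prod ?h (\<omega>, u))"
    proof (rule AE_I2)
      fix \<omega> assume "\<omega> \<in> space M"
      have "integrable ?\<Lambda> (?h \<omega>)"
        by (intro integrable_mult_right P.product_integrable_prod int1) simp
      then show "integrable ?\<Lambda> (\<lambda>u. case_prod ?h (\<omega>, u))" by simp
    qed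
  qed
  have "(CLINT \<omega>|M. iexp (l * f x \<omega>) * complex_of_real (\<Prod>j<n. normal_density (f (s j) \<omega>) \<sigma> (y j)))
      = (CLINT \<omega>|M. CLINT u|?\<Lambda>. ?h \<omega> u)"
  proof (intro Bochner_Integration.integral_cong refl)
    fix \<omega>
    have "complex_of_real (normal_density m \<sigma> b) = (CLINT u|lborel. complex_of_real (fourier_weight u) * iexp (u * (b - m)))" for m b
      unfolding fourier_weight_def by (rule fourier_normal_density[OF \<sigma>])
    then have "complex_of_real (\<Prod>j<n. normal_density (f (s j) \<omega>) \<sigma> (y j))
        = (\<Prod>j<n. CLINT u|lborel. complex_of_real (fourier_weight u) * iexp (u * (y j - f (s j) \<omega>)))"
      by (simp only: of_real_prod)
    also have "\<dots> = (CLINT u|?\<Lambda>. (\<Prod>j<n. complex_of_real (fourier_weight (u j)) * iexp (u j * (y j - f (s j) \<omega>))))"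
      by (rule P.product_integral_prod[symmetric, OF _ int1]) simp
    finally show "iexp (l * f x \<omega>) * complex_of_real (\<Prod>j<n. normal_density (f (s j) \<omega>) \<sigma> (y j)) = (CLINT u|?\<Lambda>. ?h \<omega> u)"
      by (simp only: integral_mult_right_zero)
  qed
  also have "\<dots> = (CLINT u|?\<Lambda>. CLINT \<omega>|M. ?h \<omega> u)"
    by (rule Q.Fubini_integral[OF int, symmetric])
  also have "\<dots> = (CLINT u|?\<Lambda>. fourier_integrand l u)"
  proof (intro Bochner_Integration.integral_cong refl)
    fix u
    have "?h \<omega> u = (\<Prod>j<n. complex_of_real (fourier_weight (u j)) * iexp (u j * y j))
         * iexp (l * f x \<omega> - (\<Sum>j<n. u j * f (s j) \<omega>))" for \<omega>
    proof -
      have "iexp (l * f x \<omega> - (\<Sum>j<n. u j * f (s j) \<omega>)) = iexp (l * f x \<omega>) * (\<Prod>j<n. iexp (- u j * f (s j) \<omega>))"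
        by (simp add: ring_distribs sum_distrib_left sum_negf exp_diff exp_minus exp_sum divide_inverse o_def flip: prod_inversef)
      moreover have "iexp (u j * (y j - f (s j) \<omega>)) = iexp (u j * y j) * iexp (- u j * f (s j) \<omega>)" for j
        by (simp add: ring_distribs flip: exp_add)
      ultimately show ?thesis by (simp add: prod.distrib mult_ac)
    qed
    then show "(CLINT \<omega>|M. ?h \<omega> u) = fourier_integrand l u"
      unfolding fourier_integrand_def by (simp only: integral_mult_right_zero char_joint)
  qed
  finally show ?thesis .
qed

text \<open>Writing the likelihood as a Fourier integral turns conditioning on the observations into a
  real translation of the frequency variables by \<open>l \<alpha>\<close>.\<close>

lemma char_weighted:
  "(CLINT \<omega>|M. iexp (l * f x \<omega>) * complex_of_real (\<Prod>j<n. normal_density (f (s j) \<omega>) \<sigma> (y j)))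
     = iexp (l * (\<Sum>j<n. \<alpha> j * y j)) * complex_of_real (exp (- l\<^sup>2 * (k x x - (\<Sum>j<n. \<alpha> j * k (s j) x)) / 2))
       * complex_of_real (LINT \<omega>|M. (\<Prod>j<n. normal_density (f (s j) \<omega>) \<sigma> (y j)))"
proof -
  let ?\<Lambda> = "PiM {..<n} (\<lambda>_. lborel :: real measure)"
  let ?T = "\<lambda>u. \<lambda>j\<in>{..<n}. u j + l * \<alpha> j"
  let ?c = "iexp (l * (\<Sum>j<n. \<alpha> j * y j)) * complex_of_real (exp (- l\<^sup>2 * (k x x - (\<Sum>j<n. \<alpha> j * k (s j) x)) / 2))"
  have "(CLINT u|?\<Lambda>. fourier_integrand l u) = (CLINT u|distr ?\<Lambda> ?\<Lambda> ?T. fourier_integrand l u)"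
    by (simp add: distr_PiM_lborel_translate)
  also have "\<dots> = (CLINT u|?\<Lambda>. fourier_integrand l (?T u))"
    by (rule integral_distr) measurable
  also have "\<dots> = (CLINT u|?\<Lambda>. ?c * fourier_integrand 0 u)"
    by (intro Bochner_Integration.integral_cong refl)
       (simp only: fourier_integrand_shift[symmetric], auto intro!: fourier_integrand_cong)
  also have "\<dots> = ?c * (CLINT u|?\<Lambda>. fourier_integrand 0 u)"
    by (rule integral_mult_right_zero)
  \<comment> \<open>At l = 0 the Fourier integral is the expected likelihood itself, by the same
    identity read backwards.\<close>
  also have "(CLINT u|?\<Lambda>. fourier_integrand 0 u)
      = complex_of_real (LINT \<omega>|M. (\<Prod>j<n. normal_density (f (s j) \<omega>) \<sigma> (y j)))"
    using char_weighted_eq_integral[of 0] by (simp flip: integral_complex_of_real)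
  finally show ?thesis
    unfolding char_weighted_eq_integral .
qed

end

end

section \<open>The posterior for fixed data\<close>

lemma noisy_gram_carrier [simp]: "noisy_gram k \<sigma> d \<in> carrier_mat (length d) (length d)"
  by (simp add: noisy_gram_def)

lemma noisy_gram_index:
  "i < length d \<Longrightarrow> j < length d \<Longrightarrow>
     noisy_gram k \<sigma> d $$ (i, j) = k (fst (d ! i)) (fst (d ! j)) + (if i = j then \<sigma>\<^sup>2 else 0)"
  by (simp add: noisy_gram_def)

lemma mult_mat_vec_index:
  assumes "A \<in> carrier_mat m n" "v \<in> carrier_vec n" "i < m"
  shows "(A *\<^sub>v v) $ i = (\<Sum>j<n. A $$ (i, j) * v $ j)"
  using assms by (auto simp: scalar_prod_def atLeast0LessThan)

lemma noisy_gram_mult_index: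
  assumes "v \<in> carrier_vec (length d)" "i < length d"
  shows "(noisy_gram k \<sigma> d *\<^sub>v v) $ i
    = (\<Sum>j<length d. k (fst (d ! i)) (fst (d ! j)) * v $ j) + \<sigma>\<^sup>2 * v $ i"
proof -
  have "(noisy_gram k \<sigma> d *\<^sub>v v) $ i
      = (\<Sum>j<length d. (k (fst (d ! i)) (fst (d ! j)) + (if i = j then \<sigma>\<^sup>2 else 0)) * v $ j)"
    using assms by (simp add: mult_mat_vec_index[OF noisy_gram_carrier] noisy_gram_index)
  also have "\<dots> = (\<Sum>j<length d. k (fst (d ! i)) (fst (d ! j)) * v $ j) + (\<Sum>j<length d. if i = j then \<sigma>\<^sup>2 * v $ j else 0)"
    unfolding sum.distrib[symmetric] by (intro sum.cong) (auto simp: algebra_simps)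
  finally show ?thesis using assms(2) by simp
qed

lemma kernel_vec_carrier [simp]: "kernel_vec k d x \<in> carrier_vec (length d)"
  by (simp add: kernel_vec_def)

lemma dim_kernel_vec [simp]: "dim_vec (kernel_vec k d x) = length d"
  by (simp add: kernel_vec_def)

lemma kernel_vec_index [simp]: "i < length d \<Longrightarrow> kernel_vec k d x $ i = k (fst (d ! i)) x"
  by (simp add: kernel_vec_def)

context
  fixes D :: "'a set" and k :: "'a \<Rightarrow> 'a \<Rightarrow> real" and \<sigma> :: real and d :: "'a data"
  assumes kernel: "pos_def_kernel D k" and \<sigma>: "0 < \<sigma>" and d: "fst ` set d \<subseteq> D"
begin

text \<open>The matrix K of kernel values may be singular, but a null vector v of C = K + \<sigma>^2
  I satisfies v'Kv = -\<sigma>^2 |v|^2, which the nonnegativity of K allows only for v = 0.\<close>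

lemma det_noisy_gram_nonzero: "Determinant.det (noisy_gram k \<sigma> d) \<noteq> 0"
proof
  let ?n = "length d" and ?s = "\<lambda>i. fst (d ! i)"
  assume "Determinant.det (noisy_gram k \<sigma> d) = 0"
  then obtain v where v: "v \<in> carrier_vec ?n" "v \<noteq> 0\<^sub>v ?n" "noisy_gram k \<sigma> d *\<^sub>v v = 0\<^sub>v ?n"
    unfolding det_0_iff_vec_prod_zero_field[OF noisy_gram_carrier] by auto
  have "0 \<le> (\<Sum>i<?n. \<Sum>j<?n. v $ i * v $ j * k (?s i) (?s j))"
    using d by (intro pos_def_kernel_family_nonneg[OF kernel]) auto
  also have "\<dots> = (\<Sum>i<?n. v $ i * ((noisy_gram k \<sigma> d *\<^sub>v v) $ i - \<sigma>\<^sup>2 * v $ i))"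
    using v(1) by (intro sum.cong refl)
      (simp add: noisy_gram_mult_index sum_distrib_left mult_ac del: index_mult_mat_vec)
  also have "\<dots> = - \<sigma>\<^sup>2 * (\<Sum>i<?n. (v $ i)\<^sup>2)"
    unfolding v(3) by (simp add: sum_distrib_left power2_eq_square mult_ac sum_negf)
  finally have "(\<Sum>i<?n. (v $ i)\<^sup>2) \<le> 0"
    using \<sigma> by (simp add: mult_le_0_iff)
  then have "(\<Sum>i<?n. (v $ i)\<^sup>2) = 0"
    by (intro antisym sum_nonneg) auto
  then have "\<forall>i<?n. v $ i = 0"
    by (subst (asm) sum_nonneg_eq_0_iff) auto
  with v(1,2) show False by auto
qed

lemma noisy_gram_inv:
  "noisy_gram k \<sigma> d * noisy_gram_inv k \<sigma> d = 1\<^sub>m (length d)"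
  "noisy_gram_inv k \<sigma> d * noisy_gram k \<sigma> d = 1\<^sub>m (length d)"
  "noisy_gram_inv k \<sigma> d \<in> carrier_mat (length d) (length d)"
proof -
  have "noisy_gram k \<sigma> d \<in> Units (ring_mat TYPE(real) (length d) ())"
    by (intro det_non_zero_imp_unit noisy_gram_carrier det_noisy_gram_nonzero)
  with mat_inverse(1)[OF noisy_gram_carrier, of k \<sigma> d "()"] have "mat_inverse (noisy_gram k \<sigma> d) \<noteq> None"
    by metis
  then obtain B where B: "mat_inverse (noisy_gram k \<sigma> d) = Some B"
    by auto
  from mat_inverse(2)[OF noisy_gram_carrier B] B
  show "noisy_gram k \<sigma> d * noisy_gram_inv k \<sigma> d = 1\<^sub>m (length d)"
    "noisy_gram_inv k \<sigma> d * noisy_gram k \<sigma> d = 1\<^sub>m (length d)"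
    "noisy_gram_inv k \<sigma> d \<in> carrier_mat (length d) (length d)"
    by (simp_all add: noisy_gram_inv_def)
qed

text \<open>The inverse is defined by elimination, whose branching hides how its entries depend on
  the data. Cramer's formula exhibits them as quotients of polynomials in the matrix entries, which
  yields \<open>borel_measurable_noisy_gram_inv\<close>.\<close>

lemma noisy_gram_inv_conv_adj:
  "noisy_gram_inv k \<sigma> d = (1 / Determinant.det (noisy_gram k \<sigma> d)) \<cdot>\<^sub>m adj_mat (noisy_gram k \<sigma> d)"
proof -
  let ?C = "noisy_gram k \<sigma> d" and ?B = "noisy_gram_inv k \<sigma> d" and ?n = "length d"
  have adj: "adj_mat ?C \<in> carrier_mat ?n ?n" "?C * adj_mat ?C = Determinant.det ?C \<cdot>\<^sub>m 1\<^sub>m ?n"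
    using adj_mat[OF noisy_gram_carrier] by auto
  have "adj_mat ?C = (?B * ?C) * adj_mat ?C"
    using adj(1) by (simp add: noisy_gram_inv)
  also have "\<dots> = ?B * (?C * adj_mat ?C)"
    by (rule assoc_mult_mat[OF noisy_gram_inv(3) noisy_gram_carrier adj(1)])
  also have "\<dots> = Determinant.det ?C \<cdot>\<^sub>m ?B"
    unfolding adj(2) using noisy_gram_inv(3) by (subst mult_smult_distrib) auto
  finally show ?thesis
    using det_noisy_gram_nonzero noisy_gram_inv(3) by (auto intro!: eq_matI)
qed

text \<open>These are the weights \<alpha> of the Fourier computation;
  \<open>kriging_weights_solve\<close> is the hypothesis made on \<alpha> there.\<close>

definition kriging_weights :: "'a \<Rightarrow> nat \<Rightarrow> real" where
  "kriging_weights x j = (noisy_gram_inv k \<sigma> d *\<^sub>v kernel_vec k d x) $ j"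

lemma kriging_weights_solve:
  assumes "i < length d"
  shows "(\<Sum>j<length d. k (fst (d ! i)) (fst (d ! j)) * kriging_weights x j) + \<sigma>\<^sup>2 * kriging_weights x i
     = k (fst (d ! i)) x"
proof -
  let ?v = "noisy_gram_inv k \<sigma> d *\<^sub>v kernel_vec k d x"
  have v: "?v \<in> carrier_vec (length d)"
    by (intro mult_mat_vec_carrier[OF noisy_gram_inv(3)]) simp
  have "noisy_gram k \<sigma> d *\<^sub>v ?v = (noisy_gram k \<sigma> d * noisy_gram_inv k \<sigma> d) *\<^sub>v kernel_vec k d x"
    by (rule assoc_mult_mat_vec[OF noisy_gram_carrier noisy_gram_inv(3), symmetric]) simp
  also have "\<dots> = kernel_vec k d x"
    unfolding noisy_gram_inv(1) by (rule one_mult_mat_vec) simp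
  finally show ?thesis
    using noisy_gram_mult_index[OF v assms, of k \<sigma>] assms
    unfolding kriging_weights_def by simp
qed

text \<open>Symmetry of C lets the inverse act on the kernel vector instead of on y. With v = C^{-1}
  y, the kernel vector is expanded by \<open>kriging_weights_solve\<close>, the sums are exchanged,
  and C v = y is read off row by row.\<close>

lemma post_mean_conv_kriging: "post_mean k \<sigma> d x = (\<Sum>j<length d. kriging_weights x j * snd (d ! j))"
proof -
  let ?n = "length d" and ?w = "vec_of_list (map snd d)" and ?s = "\<lambda>i. fst (d ! i)"
  let ?v = "noisy_gram_inv k \<sigma> d *\<^sub>v ?w"
  have w: "?w \<in> carrier_vec ?n" by (intro carrier_vecI) simp
  have v: "?v \<in> carrier_vec ?n"
    by (rule mult_mat_vec_carrier[OF noisy_gram_inv(3) w])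
  have sym: "k (?s i) (?s j) = k (?s j) (?s i)" if "i < ?n" "j < ?n" for i j
  proof -
    have "?s i \<in> D" "?s j \<in> D" using d that by auto
    with kernel show ?thesis unfolding pos_def_kernel_def by blast
  qed
  have Cv: "noisy_gram k \<sigma> d *\<^sub>v ?v = ?w"
    unfolding assoc_mult_mat_vec[OF noisy_gram_carrier noisy_gram_inv(3) w, symmetric] noisy_gram_inv(1)
    by (rule one_mult_mat_vec[OF w])
  have "post_mean k \<sigma> d x = (\<Sum>i<?n. k (?s i) x * ?v $ i)"
    using carrier_vecD[OF v]
    by (simp add: post_mean_def scalar_prod_def atLeast0LessThan del: index_mult_mat_vec dim_mult_mat_vec)
  also have "\<dots> = (\<Sum>i<?n. (\<Sum>j<?n. k (?s i) (?s j) * kriging_weights x j * ?v $ i) + \<sigma>\<^sup>2 * kriging_weights x i * ?v $ i)"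
  proof (intro sum.cong refl)
    fix i assume "i \<in> {..<?n}"
    then have "k (?s i) x * ?v $ i
        = ((\<Sum>j<?n. k (?s i) (?s j) * kriging_weights x j) + \<sigma>\<^sup>2 * kriging_weights x i) * ?v $ i"
      by (subst kriging_weights_solve) auto
    then show "k (?s i) x * ?v $ i
        = (\<Sum>j<?n. k (?s i) (?s j) * kriging_weights x j * ?v $ i) + \<sigma>\<^sup>2 * kriging_weights x i * ?v $ i"
      by (simp only: sum_distrib_right distrib_right)
  qed
  also have "\<dots> = (\<Sum>i<?n. \<Sum>j<?n. k (?s i) (?s j) * kriging_weights x j * ?v $ i) + (\<Sum>j<?n. \<sigma>\<^sup>2 * kriging_weights x j * ?v $ j)"
    by (rule sum.distrib)
  also have "(\<Sum>i<?n. \<Sum>j<?n. k (?s i) (?s j) * kriging_weights x j * ?v $ i)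
      = (\<Sum>j<?n. \<Sum>i<?n. k (?s j) (?s i) * kriging_weights x j * ?v $ i)"
    by (subst sum.swap, intro sum.cong refl) (simp add: sym)
  also have "\<dots> + (\<Sum>j<?n. \<sigma>\<^sup>2 * kriging_weights x j * ?v $ j)
      = (\<Sum>j<?n. kriging_weights x j * ((\<Sum>i<?n. k (?s j) (?s i) * ?v $ i) + \<sigma>\<^sup>2 * ?v $ j))"
    by (simp add: sum.distrib distrib_left sum_distrib_left mult_ac)
  also have "\<dots> = (\<Sum>j<?n. kriging_weights x j * (noisy_gram k \<sigma> d *\<^sub>v ?v) $ j)"
    by (intro sum.cong refl) (simp only: noisy_gram_mult_index[OF v] lessThan_iff)
  also have "\<dots> = (\<Sum>j<?n. kriging_weights x j * snd (d ! j))"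
    unfolding Cv by (intro sum.cong) (auto simp: vec_of_list_index)
  finally show ?thesis .
qed

lemma post_var_conv_kriging: "post_var k \<sigma> d x = k x x - (\<Sum>j<length d. kriging_weights x j * k (fst (d ! j)) x)"
proof -
  have "dim_vec (noisy_gram_inv k \<sigma> d *\<^sub>v kernel_vec k d x) = length d"
    using noisy_gram_inv(3) by simp
  then show ?thesis
    by (simp add: post_var_def post_cov_def scalar_prod_def kriging_weights_def atLeast0LessThan
        mult.commute del: index_mult_mat_vec dim_mult_mat_vec)
qed

end

section \<open>The posterior as the prior reweighted by the likelihood\<close>

definition likelihood :: "('a \<Rightarrow> 'w \<Rightarrow> real) \<Rightarrow> real \<Rightarrow> 'a data \<Rightarrow> 'w \<Rightarrow> real" where
  "likelihood f \<sigma> d \<omega> = (\<Prod>j<length d. normal_density (f (fst (d ! j)) \<omega>) \<sigma> (snd (d ! j)))"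

context gp_prior
begin

context
  fixes \<sigma> :: real and d :: "'a data"
  assumes \<sigma>: "0 < \<sigma>" and d: "fst ` set d \<subseteq> D"
begin

lemma likelihood_pos: "0 < likelihood f \<sigma> d \<omega>"
  unfolding likelihood_def by (intro prod_pos ballI normal_density_pos \<sigma>)

lemma measurable_likelihood [measurable]: "likelihood f \<sigma> d \<in> borel_measurable M"
proof -
  have [measurable]: "j < length d \<Longrightarrow> f (fst (d ! j)) \<in> borel_measurable M" for j
    using d by (intro rv_f) auto
  show ?thesis
    unfolding likelihood_def normal_density_def by measurable
qed

lemma integrable_likelihood: "integrable M (likelihood f \<sigma> d)"
proof (rule integrable_const_bound)
  have "normal_density m \<sigma> y \<le> 1 / sqrt (2 * pi * \<sigma>\<^sup>2)" for m y
    by (auto simp: normal_density_def intro!: divide_right_mono)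
  then have "likelihood f \<sigma> d \<omega> \<le> (\<Prod>j<length d. 1 / sqrt (2 * pi * \<sigma>\<^sup>2))" for \<omega>
    unfolding likelihood_def by (intro prod_mono) (auto simp: normal_density_nonneg)
  then show "AE \<omega> in M. norm (likelihood f \<sigma> d \<omega>) \<le> (1 / sqrt (2 * pi * \<sigma>\<^sup>2)) ^ length d"
    using likelihood_pos[THEN less_imp_le] by auto
qed simp

lemma evidence_pos: "0 < (LINT \<omega>|M. likelihood f \<sigma> d \<omega>)"
proof -
  have "(LINT \<omega>|M. likelihood f \<sigma> d \<omega>) \<noteq> 0"
    using integral_nonneg_eq_0_iff_AE[OF integrable_likelihood] likelihood_pos
    by (auto simp: less_imp_le less_imp_neq[THEN not_sym])
  moreover have "0 \<le> (LINT \<omega>|M. likelihood f \<sigma> d \<omega>)"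
    by (intro integral_nonneg_AE) (simp add: likelihood_pos less_imp_le)
  ultimately show ?thesis by simp
qed

text \<open>This is \<open>char_weighted\<close> with the kriging weights as \<alpha>. Subtracting
  the mean removes the phase, so up to the total mass only the characteristic function of a centred
  normal law is left.\<close>

lemma char_posterior:
  assumes x: "x \<in> D"
  shows "(CLINT \<omega>|M. iexp (l * (f x \<omega> - post_mean k \<sigma> d x)) * complex_of_real (likelihood f \<sigma> d \<omega>))
    = complex_of_real (exp (- l\<^sup>2 * post_var k \<sigma> d x / 2)) * complex_of_real (LINT \<omega>|M. likelihood f \<sigma> d \<omega>)"
proof -
  let ?\<mu> = "post_mean k \<sigma> d x"
  let ?e = "complex_of_real (exp (- l\<^sup>2 * post_var k \<sigma> d x / 2))"
  have "(CLINT \<omega>|M. iexp (l * (f x \<omega> - ?\<mu>)) * complex_of_real (likelihood f \<sigma> d \<omega>))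
      = (CLINT \<omega>|M. iexp (- l * ?\<mu>) * (iexp (l * f x \<omega>) * complex_of_real (likelihood f \<sigma> d \<omega>)))"
    by (intro Bochner_Integration.integral_cong refl) (simp add: ring_distribs exp_diff exp_minus divide_inverse)
  also have "\<dots> = iexp (- l * ?\<mu>) * (CLINT \<omega>|M. iexp (l * f x \<omega>) * complex_of_real (likelihood f \<sigma> d \<omega>))"
    by (rule integral_mult_right_zero)
  also have "(CLINT \<omega>|M. iexp (l * f x \<omega>) * complex_of_real (likelihood f \<sigma> d \<omega>))
      = iexp (l * ?\<mu>) * ?e * complex_of_real (LINT \<omega>|M. likelihood f \<sigma> d \<omega>)"
    unfolding likelihood_def post_mean_conv_kriging[OF kernel \<sigma> d] post_var_conv_kriging[OF kernel \<sigma> d]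
    using d by (intro char_weighted[OF _ x \<sigma>] kriging_weights_solve[OF kernel \<sigma> d]) auto
  finally show ?thesis
    by (simp add: exp_minus mult.assoc[symmetric])
qed

text \<open>The observed values are arbitrary here, so this holds for every realisation of adaptively
  chosen data.\<close>

proposition posterior_tail:
  assumes x: "x \<in> D" and \<beta>: "0 \<le> \<beta>"
  shows "(\<integral>\<^sup>+\<omega>. indicator {\<omega>. sqrt \<beta> * sqrt (post_var k \<sigma> d x) < \<bar>f x \<omega> - post_mean k \<sigma> d x\<bar>} \<omega>
        * ennreal (likelihood f \<sigma> d \<omega>) \<partial>M)
    \<le> ennreal (exp (- \<beta> / 2)) * (\<integral>\<^sup>+\<omega>. ennreal (likelihood f \<sigma> d \<omega>) \<partial>M)"
proof -
  let ?\<mu> = "post_mean k \<sigma> d x" and ?v = "post_var k \<sigma> d x"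
  define Z where "Z = (LINT \<omega>|M. likelihood f \<sigma> d \<omega>)"
  \<comment> \<open>The posterior probability measure on sample points: M reweighted by the
    likelihood of the fixed data and normalised.\<close>
  define N where "N = density M (\<lambda>\<omega>. ennreal (likelihood f \<sigma> d \<omega> / Z))"
  have Z: "0 < Z" unfolding Z_def by (rule evidence_pos)
  have [measurable]: "f x \<in> borel_measurable M" by (rule rv_f[OF x])
  have nnZ: "(\<integral>\<^sup>+\<omega>. ennreal (likelihood f \<sigma> d \<omega>) \<partial>M) = ennreal Z"
    unfolding Z_def by (intro nn_integral_eq_integral integrable_likelihood) (simp add: likelihood_pos less_imp_le)
  have "emeasure N (space N) = (\<integral>\<^sup>+\<omega>. ennreal (likelihood f \<sigma> d \<omega>) / ennreal Z \<partial>M)"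
    unfolding N_def using Z less_imp_le[OF likelihood_pos]
    by (simp add: emeasure_density divide_ennreal cong: nn_integral_cong)
  also have "\<dots> = 1"
    using Z by (subst nn_integral_divide) (auto simp: nnZ divide_ennreal)
  finally interpret N: prob_space N
    by (rule prob_spaceI)
  have [measurable_cong]: "sets N = sets M" by (simp add: N_def)
  have char: "char (distr N borel (\<lambda>\<omega>. f x \<omega> - ?\<mu>)) l = complex_of_real (exp (- ?v * l\<^sup>2 / 2))" for l
  proof -
    have "char (distr N borel (\<lambda>\<omega>. f x \<omega> - ?\<mu>)) l = (CLINT \<omega>|N. iexp (l * (f x \<omega> - ?\<mu>)))"
      unfolding char_def by (rule integral_distr) measurable
    also have "\<dots> = (CLINT \<omega>|M. (likelihood f \<sigma> d \<omega> / Z) *\<^sub>R iexp (l * (f x \<omega> - ?\<mu>)))"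
      unfolding N_def using Z likelihood_pos by (intro integral_density) (auto simp: less_imp_le)
    also have "\<dots> = (CLINT \<omega>|M. (1 / Z) * (iexp (l * (f x \<omega> - ?\<mu>)) * complex_of_real (likelihood f \<sigma> d \<omega>)))"
      by (intro Bochner_Integration.integral_cong refl) (simp add: scaleR_conv_of_real)
    also have "\<dots> = complex_of_real (1 / Z) * (complex_of_real (exp (- l\<^sup>2 * ?v / 2)) * complex_of_real Z)"
      unfolding char_posterior[OF x, folded Z_def, symmetric] by (rule integral_mult_right_zero)
    also have "\<dots> = complex_of_real (exp (- ?v * l\<^sup>2 / 2))"
      using Z by (simp add: mult.commute)
    finally show ?thesis .
  qed
  have dist: "real_distribution (distr N borel (\<lambda>\<omega>. f x \<omega> - ?\<mu>))"
    by (intro N.real_distribution_distr) measurable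
  \<comment> \<open>No matrix algebra is involved: a characteristic function is bounded by 1, and at
    frequency 1 this one equals exp(-v/2).\<close>
  have v: "0 \<le> ?v"
    using real_distribution.cmod_char_le_1[OF dist, of 1] unfolding char by simp
  have law: "distr N borel (\<lambda>\<omega>. f x \<omega> - ?\<mu>) = normal_law 0 ?v"
    by (intro Levy_uniqueness dist real_distribution_normal_law v ext) (simp add: char char_normal_law[OF v])
  have "(\<integral>\<^sup>+\<omega>. indicator {\<omega>. sqrt \<beta> * sqrt ?v < \<bar>f x \<omega> - ?\<mu>\<bar>} \<omega> * ennreal (likelihood f \<sigma> d \<omega>) \<partial>M)
      = (\<integral>\<^sup>+\<omega>. ennreal Z * (ennreal (likelihood f \<sigma> d \<omega> / Z)
          * indicator {\<omega> \<in> space M. sqrt \<beta> * sqrt ?v < \<bar>f x \<omega> - ?\<mu>\<bar>} \<omega>) \<partial>M)"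
  proof (intro nn_integral_cong)
    fix \<omega> assume "\<omega> \<in> space M"
    moreover have "ennreal (likelihood f \<sigma> d \<omega>) = ennreal Z * ennreal (likelihood f \<sigma> d \<omega> / Z)"
      using Z likelihood_pos[of \<omega>] by (subst ennreal_mult[symmetric]) auto
    ultimately show "indicator {\<omega>. sqrt \<beta> * sqrt ?v < \<bar>f x \<omega> - ?\<mu>\<bar>} \<omega> * ennreal (likelihood f \<sigma> d \<omega>)
        = ennreal Z * (ennreal (likelihood f \<sigma> d \<omega> / Z) * indicator {\<omega> \<in> space M. sqrt \<beta> * sqrt ?v < \<bar>f x \<omega> - ?\<mu>\<bar>} \<omega>)"
      by (auto simp: indicator_def)
  qed
  also have "\<dots> = ennreal Z * emeasure N {\<omega> \<in> space M. sqrt \<beta> * sqrt ?v < \<bar>f x \<omega> - ?\<mu>\<bar>}"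
    unfolding N_def by (subst nn_integral_cmult) (auto simp: emeasure_density)
  also have "emeasure N {\<omega> \<in> space M. sqrt \<beta> * sqrt ?v < \<bar>f x \<omega> - ?\<mu>\<bar>}
      = emeasure (distr N borel (\<lambda>\<omega>. f x \<omega> - ?\<mu>)) {z. sqrt \<beta> * sqrt ?v < \<bar>z\<bar>}"
    by (subst emeasure_distr) (auto simp: N_def vimage_def Int_def conj_commute)
  finally show ?thesis
    unfolding nnZ law using mult_left_mono[OF normal_law_two_sided_tail[OF v \<beta>], of "ennreal Z"]
    by (simp add: mult.commute)
qed

end

end

section \<open>Measurability of the posterior\<close>

lemma borel_measurable_det:
  fixes A :: "'b \<Rightarrow> real mat"
  assumes A: "\<And>w. A w \<in> carrier_mat n n"
    and meas: "\<And>i j. i < n \<Longrightarrow> j < n \<Longrightarrow> (\<lambda>w. A w $$ (i, j)) \<in> borel_measurable N"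
  shows "(\<lambda>w. Determinant.det (A w)) \<in> borel_measurable N"
proof -
  have "(\<lambda>w. \<Prod>i = 0..<n. A w $$ (i, \<pi> i)) \<in> borel_measurable N" if "\<pi> permutes {0..<n}" for \<pi>
    using that by (intro borel_measurable_prod meas) (auto simp: permutes_def dest: permutes_in_image)
  then show ?thesis
    unfolding det_def'[OF A] by (intro borel_measurable_sum borel_measurable_times) auto
qed

lemma borel_measurable_adj_mat:
  fixes A :: "'b \<Rightarrow> real mat"
  assumes A: "\<And>w. A w \<in> carrier_mat n n"
    and meas: "\<And>i j. i < n \<Longrightarrow> j < n \<Longrightarrow> (\<lambda>w. A w $$ (i, j)) \<in> borel_measurable N"
    and ij: "i < n" "j < n"
  shows "(\<lambda>w. adj_mat (A w) $$ (i, j)) \<in> borel_measurable N"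
proof -
  have dims: "dim_row (A w) = n" "dim_col (A w) = n" for w using A[of w] by auto
  have "(\<lambda>w. Determinant.det (mat_delete (A w) j i)) \<in> borel_measurable N"
  proof (rule borel_measurable_det)
    show "mat_delete (A w) j i \<in> carrier_mat (n - 1) (n - 1)" for w
      using A by (rule mat_delete_carrier)
    show "(\<lambda>w. mat_delete (A w) j i $$ (i', j')) \<in> borel_measurable N" if "i' < n - 1" "j' < n - 1" for i' j'
    proof -
      have "(\<lambda>w. mat_delete (A w) j i $$ (i', j'))
          = (\<lambda>w. A w $$ (if i' < j then i' else Suc i', if j' < i then j' else Suc j'))"
        using that by (simp add: mat_delete_def dims)
      then show ?thesis
        using that by (simp only:) (intro meas, auto)
    qed
  qed
  then show ?thesis
    using ij by (simp add: adj_mat_def dims cofactor_def)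
qed

lemma space_generated_by [simp]: "space (generated_by M I X N) = space M"
  by (simp add: generated_by_def space_measure_of_conv)

lemma sets_generated_by:
  "sets (generated_by M I X N) = sigma_sets (space M) {X i -` B \<inter> space M | i B. i \<in> I \<and> B \<in> sets N}"
  unfolding generated_by_def by (rule sets_measure_of) auto

lemma measurable_generated_by:
  assumes "i \<in> I" "X i \<in> space M \<rightarrow> space N"
  shows "X i \<in> generated_by M I X N \<rightarrow>\<^sub>M N"
  using assms by (intro measurableI) (auto simp: sets_generated_by)

context gp_prior
begin

lemma sets_generated_by_D: "sets (generated_by M D f borel) \<subseteq> sets M"
  unfolding sets_generated_by using rv_f by (intro sets.sigma_sets_subset) (auto intro: measurable_sets)

lemma f_jointly_measurable:
  "(\<lambda>p. f (fst p) (snd p)) \<in> borel_measurable (restrict_space borel D \<Otimes>\<^sub>M generated_by M D f borel)"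
  using prior by (simp add: gaussian_process_def case_prod_beta')

lemma measurable_f_comp:
  assumes "X \<in> N \<rightarrow>\<^sub>M restrict_space borel D" "Y \<in> N \<rightarrow>\<^sub>M generated_by M D f borel"
  shows "(\<lambda>w. f (X w) (Y w)) \<in> borel_measurable N"
  using measurable_compose[OF measurable_Pair[OF assms] f_jointly_measurable] by simp

lemma measurable_ident_generated: "(\<lambda>\<omega>. \<omega>) \<in> M \<rightarrow>\<^sub>M generated_by M D f borel"
  using sets_generated_by_D by (intro measurableI) (auto simp: Int_absorb2 sets.sets_into_space)

text \<open>Polarisation for characteristic functions: the variances of f(x) + f(x') and f(x) -
  f(x') differ by 4 k(x, x'), and the modulus of the characteristic function at 1 is
  exp(-variance/2). Thus k is expressed through expectations over f.\<close>

lemma kernel_conv_char: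
  assumes "x \<in> D" "x' \<in> D"
  shows "k x x' = (ln (cmod (CLINT \<omega>|M. iexp (f x \<omega> - f x' \<omega>))) - ln (cmod (CLINT \<omega>|M. iexp (f x \<omega> + f x' \<omega>)))) / 2"
proof -
  have *: "cmod (CLINT \<omega>|M. iexp (f x \<omega> + e * f x' \<omega>)) = exp (- (k x x + 2 * e * k x x' + e\<^sup>2 * k x' x') / 2)" for e
  proof -
    let ?a = "\<lambda>i::nat. if i = 0 then 1 else e" and ?s = "\<lambda>i::nat. if i = 0 then x else x'"
    have char: "(CLINT \<omega>|M. iexp (\<Sum>i\<in>{..<2}. ?a i * f (?s i) \<omega>))
      = complex_of_real (exp (- (\<Sum>i\<in>{..<2}. \<Sum>j\<in>{..<2}. ?a i * ?a j * k (?s i) (?s j)) / 2))"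
      using assms by (intro char_linear_combination) auto
    have lin: "(\<Sum>i\<in>{..<2}. ?a i * f (?s i) \<omega>) = f x \<omega> + e * f x' \<omega>" for \<omega>
      by (simp add: numeral_2_eq_2)
    have var: "(\<Sum>i\<in>{..<2}. \<Sum>j\<in>{..<2}. ?a i * ?a j * k (?s i) (?s j)) = k x x + 2 * e * k x x' + e\<^sup>2 * k x' x'"
      using kernel_sym[OF assms] by (simp add: numeral_2_eq_2 power2_eq_square)
    show ?thesis
      using char unfolding lin var by (simp only: norm_of_real abs_exp_cancel)
  qed
  show ?thesis
    using *[of 1] *[of "-1"] by (simp add: field_simps)
qed

text \<open>Through \<open>kernel_conv_char\<close> the kernel becomes a function of parameter
  integrals over \<omega>, whose measurability in w comes from the joint measurability of f.\<close>

lemma measurable_kernel: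
  assumes X[measurable]: "X \<in> N \<rightarrow>\<^sub>M restrict_space borel D" and Y[measurable]: "Y \<in> N \<rightarrow>\<^sub>M restrict_space borel D"
  shows "(\<lambda>w. k (X w) (Y w)) \<in> borel_measurable N"
proof -
  have D: "X w \<in> D" "Y w \<in> D" if "w \<in> space N" for w
    using measurable_space[OF X that] measurable_space[OF Y that] by (auto simp: space_restrict_space)
  note [measurable] = measurable_ident_generated
  have [measurable]: "(\<lambda>p. f (X (fst p)) (snd p)) \<in> borel_measurable (N \<Otimes>\<^sub>M M)"
    "(\<lambda>p. f (Y (fst p)) (snd p)) \<in> borel_measurable (N \<Otimes>\<^sub>M M)"
    by (intro measurable_f_comp measurable_compose[OF measurable_fst X] measurable_compose[OF measurable_fst Y]
        measurable_compose[OF measurable_snd measurable_ident_generated])+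
  have "(\<lambda>w. (ln (cmod (CLINT \<omega>|M. iexp (f (X w) \<omega> - f (Y w) \<omega>)))
      - ln (cmod (CLINT \<omega>|M. iexp (f (X w) \<omega> + f (Y w) \<omega>)))) / 2) \<in> borel_measurable N"
    by (intro borel_measurable_divide borel_measurable_diff borel_measurable_ln borel_measurable_norm
        borel_measurable_lebesgue_integral) (auto simp: case_prod_beta')
  then show ?thesis
    by (rule measurable_cong[THEN iffD1, rotated]) (simp only: kernel_conv_char[OF D])
qed

section \<open>Posterior mean and variance of measurably varying data\<close>

context
  fixes N :: "'b measure" and p :: "nat \<Rightarrow> 'b \<Rightarrow> 'a" and y :: "nat \<Rightarrow> 'b \<Rightarrow> real" and n :: nat and \<sigma> :: real and x :: 'a
  assumes p: "\<And>j. j < n \<Longrightarrow> p j \<in> N \<rightarrow>\<^sub>M restrict_space borel D"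
    and y: "\<And>j. j < n \<Longrightarrow> y j \<in> borel_measurable N"
    and \<sigma>: "0 < \<sigma>" and x: "x \<in> D"
begin

lemma data_points_in_D: "w \<in> space N \<Longrightarrow> fst ` set (map (\<lambda>j. (p j w, y j w)) [0..<n]) \<subseteq> D"
  using measurable_space[OF p] by (auto simp: space_restrict_space)

lemma borel_measurable_noisy_gram_inv:
  assumes ij: "i < n" "j < n"
  shows "(\<lambda>w. noisy_gram_inv k \<sigma> (map (\<lambda>j. (p j w, y j w)) [0..<n]) $$ (i, j)) \<in> borel_measurable N"
proof -
  let ?d = "\<lambda>w. map (\<lambda>j. (p j w, y j w)) [0..<n]"
  let ?C = "\<lambda>w. noisy_gram k \<sigma> (?d w)"
  have C: "?C w \<in> carrier_mat n n" for w
    using noisy_gram_carrier[of k \<sigma> "?d w"] by simp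
  have "(\<lambda>w. ?C w $$ (i, j)) \<in> borel_measurable N" if "i < n" "j < n" for i j
    using that by (auto simp: noisy_gram_index intro!: measurable_kernel p borel_measurable_add)
  note meas = borel_measurable_det[OF C this] borel_measurable_adj_mat[OF C this ij]
  have "(\<lambda>w. 1 / Determinant.det (?C w) * adj_mat (?C w) $$ (i, j)) \<in> borel_measurable N"
    using meas by (intro borel_measurable_times borel_measurable_divide) auto
  moreover have "noisy_gram_inv k \<sigma> (?d w) $$ (i, j) = 1 / Determinant.det (?C w) * adj_mat (?C w) $$ (i, j)"
    if "w \<in> space N" for w
    using carrier_matD[OF adj_mat(1)[OF C[of w]]] ij
    by (subst noisy_gram_inv_conv_adj[OF kernel \<sigma> data_points_in_D[OF that]]) simp
  ultimately show ?thesis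
    by (subst measurable_cong) auto
qed

lemma borel_measurable_post_mean:
  "(\<lambda>w. post_mean k \<sigma> (map (\<lambda>j. (p j w, y j w)) [0..<n]) x) \<in> borel_measurable N"
proof -
  let ?d = "\<lambda>w. map (\<lambda>j. (p j w, y j w)) [0..<n]"
  have "(\<lambda>w. \<Sum>i<n. k (p i w) x * (\<Sum>j<n. noisy_gram_inv k \<sigma> (?d w) $$ (i, j) * y j w)) \<in> borel_measurable N"
    using x by (intro borel_measurable_sum borel_measurable_times borel_measurable_noisy_gram_inv measurable_kernel p y)
      (auto intro!: measurable_restrict_space2)
  moreover have "post_mean k \<sigma> (?d w) x = (\<Sum>i<n. k (p i w) x * (\<Sum>j<n. noisy_gram_inv k \<sigma> (?d w) $$ (i, j) * y j w))"
    if "w \<in> space N" for w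
  proof -
    have B: "noisy_gram_inv k \<sigma> (?d w) \<in> carrier_mat n n"
      using noisy_gram_inv(3)[OF kernel \<sigma> data_points_in_D[OF that]] by simp
    have v: "vec_of_list (map snd (?d w)) \<in> carrier_vec n"
      by (intro carrier_vecI) simp
    have i: "(noisy_gram_inv k \<sigma> (?d w) *\<^sub>v vec_of_list (map snd (?d w))) $ i
        = (\<Sum>j<n. noisy_gram_inv k \<sigma> (?d w) $$ (i, j) * y j w)" if "i < n" for i
      unfolding mult_mat_vec_index[OF B v that]
      by (intro sum.cong) (auto simp: vec_of_list_index simp del: vec_of_list_map)
    have "post_mean k \<sigma> (?d w) x = (\<Sum>i<n. kernel_vec k (?d w) x $ i
        * (noisy_gram_inv k \<sigma> (?d w) *\<^sub>v vec_of_list (map snd (?d w))) $ i)"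
      unfolding post_mean_def scalar_prod_def using carrier_matD(1)[OF B]
      by (simp add: atLeast0LessThan)
    also have "\<dots> = (\<Sum>i<n. k (p i w) x * (\<Sum>j<n. noisy_gram_inv k \<sigma> (?d w) $$ (i, j) * y j w))"
      by (intro sum.cong refl arg_cong2[where f="(*)"] i) auto
    finally show ?thesis .
  qed
  ultimately show ?thesis
    by (subst measurable_cong) auto
qed

lemma borel_measurable_post_var:
  "(\<lambda>w. post_var k \<sigma> (map (\<lambda>j. (p j w, y j w)) [0..<n]) x) \<in> borel_measurable N"
proof -
  let ?d = "\<lambda>w. map (\<lambda>j. (p j w, y j w)) [0..<n]"
  have "(\<lambda>w. k x x - (\<Sum>i<n. k (p i w) x * (\<Sum>j<n. noisy_gram_inv k \<sigma> (?d w) $$ (i, j) * k (p j w) x))) \<in> borel_measurable N"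
    using x by (intro borel_measurable_diff borel_measurable_sum borel_measurable_times
        borel_measurable_noisy_gram_inv measurable_kernel p y borel_measurable_const)
      (auto intro!: measurable_restrict_space2)
  moreover have "post_var k \<sigma> (?d w) x
      = k x x - (\<Sum>i<n. k (p i w) x * (\<Sum>j<n. noisy_gram_inv k \<sigma> (?d w) $$ (i, j) * k (p j w) x))"
    if "w \<in> space N" for w
  proof -
    have B: "noisy_gram_inv k \<sigma> (?d w) \<in> carrier_mat n n"
      using noisy_gram_inv(3)[OF kernel \<sigma> data_points_in_D[OF that]] by simp
    have v: "kernel_vec k (?d w) x \<in> carrier_vec n"
      by (intro carrier_vecI) simp
    have i: "(noisy_gram_inv k \<sigma> (?d w) *\<^sub>v kernel_vec k (?d w) x) $ i
        = (\<Sum>j<n. noisy_gram_inv k \<sigma> (?d w) $$ (i, j) * k (p j w) x)" if "i < n" for i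
      unfolding mult_mat_vec_index[OF B v that] by (intro sum.cong) auto
    have "post_var k \<sigma> (?d w) x = k x x - (\<Sum>i<n. kernel_vec k (?d w) x $ i
        * (noisy_gram_inv k \<sigma> (?d w) *\<^sub>v kernel_vec k (?d w) x) $ i)"
      unfolding post_var_def post_cov_def scalar_prod_def using carrier_matD(1)[OF B]
      by (simp add: atLeast0LessThan)
    also have "\<dots> = k x x - (\<Sum>i<n. k (p i w) x * (\<Sum>j<n. noisy_gram_inv k \<sigma> (?d w) $$ (i, j) * k (p j w) x))"
      by (intro arg_cong2[where f="(-)"] sum.cong refl arg_cong2[where f="(*)"] i) auto
    finally show ?thesis .
  qed
  ultimately show ?thesis
    by (subst measurable_cong) auto
qed

end

end

section \<open>Independent families of algebras\<close>

definition joined_algebra :: "'w measure \<Rightarrow> ('i \<Rightarrow> 'w measure) \<Rightarrow> 'i set \<Rightarrow> 'w measure" where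
  "joined_algebra M \<A> I = sigma (space M) (\<Union>i\<in>I. sets (\<A> i))"

context prob_space
begin

context
  fixes \<A> :: "'i \<Rightarrow> 'a measure" and I :: "'i set"
  assumes indep: "indep_sets (\<lambda>i. sets (\<A> i)) I"
    and space: "\<And>i. i \<in> I \<Longrightarrow> space (\<A> i) = space M"
begin

lemma algebra_subset: "i \<in> I \<Longrightarrow> sets (\<A> i) \<subseteq> sets M"
  using indep by (auto simp: indep_sets_def)

lemma space_joined_algebra [simp]: "space (joined_algebra M \<A> A) = space M"
  by (simp add: joined_algebra_def space_measure_of_conv)

lemma sets_joined_algebra:
  assumes "A \<subseteq> I"
  shows "sets (joined_algebra M \<A> A) = sigma_sets (space M) (\<Union>i\<in>A. sets (\<A> i))"
proof -
  have "(\<Union>i\<in>A. sets (\<A> i)) \<subseteq> Pow (space M)"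
    using assms algebra_subset sets.sets_into_space by blast
  then show ?thesis by (simp add: joined_algebra_def)
qed

lemma joined_algebra_subset: "A \<subseteq> I \<Longrightarrow> sets (joined_algebra M \<A> A) \<subseteq> sets M"
  using algebra_subset by (subst sets_joined_algebra) (auto intro!: sets.sigma_sets_subset)

lemma measurable_joined_algebra_ident: "A \<subseteq> I \<Longrightarrow> (\<lambda>\<omega>. \<omega>) \<in> M \<rightarrow>\<^sub>M joined_algebra M \<A> A"
  using joined_algebra_subset[of A] by (intro measurableI) (auto simp: Int_absorb2 sets.sets_into_space)

lemma measurable_joined_algebra_mono:
  assumes "A \<subseteq> B" "B \<subseteq> I"
  shows "(\<lambda>\<omega>. \<omega>) \<in> joined_algebra M \<A> B \<rightarrow>\<^sub>M joined_algebra M \<A> A"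
proof -
  have "sets (joined_algebra M \<A> A) \<subseteq> sets (joined_algebra M \<A> B)"
    using assms by (simp add: sets_joined_algebra sigma_sets_mono' UN_mono)
  then show ?thesis
    by (intro measurableI) (auto simp: Int_absorb2 sets.sets_into_space)
qed

lemma measurable_joined_algebra_component:
  assumes "i \<in> A" "A \<subseteq> I"
  shows "(\<lambda>\<omega>. \<omega>) \<in> joined_algebra M \<A> A \<rightarrow>\<^sub>M \<A> i"
proof -
  have "sets (\<A> i) \<subseteq> sets (joined_algebra M \<A> A)"
    using assms by (auto simp: sets_joined_algebra)
  moreover have "space (\<A> i) = space M"
    using assms by (intro space) auto
  moreover have "B \<subseteq> space M" if "B \<in> sets (\<A> i)" for B
    using sets.sets_into_space[OF that] \<open>space (\<A> i) = space M\<close> by simp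
  ultimately show ?thesis
    by (intro measurableI) (auto simp: Int_absorb2)
qed

text \<open>Disjoint groups of sources are independent, so the map from \<omega> to (\<omega>,
  \<omega>), read into the two joined algebras, has a product law. A function on the diagonal is
  then integrated as if its two arguments were independent copies.\<close>

lemma nn_integral_decouple:
  assumes AB: "A \<subseteq> I" "B \<subseteq> I" "A \<inter> B = {}"
    and \<Psi>: "\<Psi> \<in> borel_measurable (joined_algebra M \<A> A \<Otimes>\<^sub>M joined_algebra M \<A> B)"
  shows "(\<integral>\<^sup>+\<omega>. \<Psi> (\<omega>, \<omega>) \<partial>M) = (\<integral>\<^sup>+\<omega>1. \<integral>\<^sup>+\<omega>2. \<Psi> (\<omega>1, \<omega>2) \<partial>M \<partial>M)"
proof -
  let ?S = "joined_algebra M \<A> A" and ?T = "joined_algebra M \<A> B"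
  have S[measurable]: "(\<lambda>\<omega>. \<omega>) \<in> M \<rightarrow>\<^sub>M ?S" and T[measurable]: "(\<lambda>\<omega>. \<omega>) \<in> M \<rightarrow>\<^sub>M ?T"
    using AB by (auto intro: measurable_joined_algebra_ident)
  \<comment> \<open>Independence of random variables is stated through preimages; for the identity
    map these are the algebras themselves.\<close>
  have pull: "{(\<lambda>\<omega>. \<omega>) -` X \<inter> space M | X. X \<in> sets (joined_algebra M \<A> C)} = sets (joined_algebra M \<A> C)" for C
  proof -
    have "(\<lambda>\<omega>. \<omega>) -` X \<inter> space M = X" if "X \<in> sets (joined_algebra M \<A> C)" for X
      using sets.sets_into_space[OF that] by auto
    then show ?thesis by (auto intro: exI)
  qed
  have self: "sigma_sets (space M) (sets (joined_algebra M \<A> C)) = sets (joined_algebra M \<A> C)" for C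
    using sets.sigma_sets_eq[of "joined_algebra M \<A> C"] by simp
  have "indep_sets (\<lambda>b. sigma_sets (space M) (\<Union>i\<in>case_bool A B b. sets (\<A> i))) UNIV"
  proof (rule indep_sets_collect_sigma)
    show "indep_sets (\<lambda>i. sets (\<A> i)) (\<Union>b\<in>UNIV. case_bool A B b)"
      using AB by (intro indep_sets_mono_index[OF _ indep]) (auto split: bool.splits)
    show "disjoint_family_on (case_bool A B) UNIV"
      using AB by (auto simp: disjoint_family_on_def split: bool.splits)
  qed (auto intro: sets.Int_stable)
  moreover have "(\<lambda>b. sigma_sets (space M) (\<Union>i\<in>case_bool A B b. sets (\<A> i)))
      = case_bool (sets ?S) (sets ?T)"
    using AB by (auto simp: fun_eq_iff sets_joined_algebra split: bool.splits)
  ultimately have "indep_set (sets ?S) (sets ?T)"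
    by (simp add: indep_set_def)
  then have "indep_var ?S (\<lambda>\<omega>. \<omega>) ?T (\<lambda>\<omega>. \<omega>)"
    unfolding indep_var_eq pull self using S T by simp
  then have prod: "distr M ?S (\<lambda>\<omega>. \<omega>) \<Otimes>\<^sub>M distr M ?T (\<lambda>\<omega>. \<omega>) = distr M (?S \<Otimes>\<^sub>M ?T) (\<lambda>\<omega>. (\<omega>, \<omega>))"
    unfolding indep_var_distribution_eq by simp
  interpret T: prob_space "distr M ?T (\<lambda>\<omega>. \<omega>)" by (rule prob_space_distr[OF T])
  have "(\<integral>\<^sup>+\<omega>. \<Psi> (\<omega>, \<omega>) \<partial>M) = integral\<^sup>N (distr M (?S \<Otimes>\<^sub>M ?T) (\<lambda>\<omega>. (\<omega>, \<omega>))) \<Psi>"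
    using \<Psi> by (subst nn_integral_distr) auto
  also have "\<dots> = (\<integral>\<^sup>+\<omega>1. \<integral>\<^sup>+\<omega>2. \<Psi> (\<omega>1, \<omega>2) \<partial>distr M ?T (\<lambda>\<omega>. \<omega>) \<partial>distr M ?S (\<lambda>\<omega>. \<omega>))"
    unfolding prod[symmetric] using \<Psi> by (intro T.nn_integral_fst[symmetric]) simp
  also have "\<dots> = (\<integral>\<^sup>+\<omega>1. \<integral>\<^sup>+\<omega>2. \<Psi> (\<omega>1, \<omega>2) \<partial>distr M ?T (\<lambda>\<omega>. \<omega>) \<partial>M)"
    using T.borel_measurable_nn_integral_fst[of \<Psi> ?S] \<Psi> by (intro nn_integral_distr) simp_all
  also have "\<dots> = (\<integral>\<^sup>+\<omega>1. \<integral>\<^sup>+\<omega>2. \<Psi> (\<omega>1, \<omega>2) \<partial>M \<partial>M)"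
    using \<Psi> by (intro nn_integral_cong nn_integral_distr) auto
  finally show ?thesis .
qed

end

end

section \<open>Runs of the algorithm\<close>

locale classification_run = gp_prior M D k f
  for M :: "'w measure" and D :: "'a::euclidean_space set" and k :: "'a \<Rightarrow> 'a \<Rightarrow> real" and f :: "'a \<Rightarrow> 'w \<Rightarrow> real" +
  fixes \<Omega> :: "'a set" and \<sigma> :: real and K n0 :: nat
    and s0 :: "nat \<Rightarrow> 'w \<Rightarrow> 'a" and r :: "nat \<Rightarrow> 'w \<Rightarrow> bool" and C :: "nat \<Rightarrow> 'w \<Rightarrow> 'a \<times> nat"
    and S :: "nat \<Rightarrow> 'a \<Rightarrow> nat \<Rightarrow> 'w \<Rightarrow> 'a" and \<rho> :: "nat \<Rightarrow> 'w \<Rightarrow> real" and pick :: "nat \<Rightarrow> 'a data \<Rightarrow> 'a \<times> nat"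
  assumes \<Omega>: "finite \<Omega>" and \<sigma>: "0 < \<sigma>"
    and init: "\<And>j \<omega>. j < n0 \<Longrightarrow> \<omega> \<in> space M \<Longrightarrow> s0 j \<omega> \<in> D"
    and cand: "\<And>t \<omega>. 1 \<le> t \<Longrightarrow> \<omega> \<in> space M \<Longrightarrow> C t \<omega> \<in> \<Omega> \<times> {1..K}"
    and input: "\<And>t x i \<omega>. 1 \<le> t \<Longrightarrow> x \<in> \<Omega> \<Longrightarrow> i \<in> {1..K} \<Longrightarrow> \<omega> \<in> space M \<Longrightarrow> S t x i \<omega> \<in> D"
    and noise: "\<And>j. distributed M lborel (\<rho> j) (\<lambda>y. ennreal (normal_density 0 \<sigma> y))"
    and indep: "indep_sets (\<lambda>src. sets (source_algebra M D \<Omega> K f n0 s0 r C S \<rho> src)) sources"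
    and pick: "\<And>t. (\<lambda>z. pick t (map z [0..<n0 + t]))
            \<in> PiM {..<n0 + t} (\<lambda>_. borel) \<rightarrow>\<^sub>M count_space (\<Omega> \<times> {1..K})"
begin

abbreviation "src_algebra \<equiv> source_algebra M D \<Omega> K f n0 s0 r C S \<rho>"
abbreviation "algebra_of \<equiv> joined_algebra M src_algebra"
abbreviation "run \<equiv> run_data f n0 s0 r C S \<rho> pick"
abbreviation \<Lambda> :: "nat \<Rightarrow> (nat \<Rightarrow> real) measure" where
  "\<Lambda> n \<equiv> PiM {..<n} (\<lambda>_. lborel)"

text \<open>Every source but f and the noise: the part of the randomness that is frozen while f is
  integrated out.\<close>

definition design :: "source set" where
  "design = {Init} \<union> Bern ` {1..} \<union> Cand ` {1..} \<union> Input ` {1..}"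

lemma sources_simps [simp]: "Fun \<in> sources" "Noise j \<in> sources" "Noise ` X \<subseteq> sources"
  by (auto simp: sources_def)

lemma design_subset: "design \<subseteq> sources" "insert Fun design \<subseteq> sources" "Fun \<notin> design"
  "insert Fun design \<union> Noise ` X \<subseteq> sources" "Noise j \<notin> design" "{Fun} \<subseteq> sources" "{Noise j} \<subseteq> sources"
  by (auto simp: design_def sources_def)

lemma src_algebra_Fun: "src_algebra Fun = generated_by M D f borel"
  by (simp add: source_algebra_def)

lemma space_src_algebra: "space (src_algebra src) = space M"
  by (cases src) (auto simp: source_algebra_def)

lemmas space_algebra_of [simp] = space_joined_algebra[OF indep space_src_algebra]
lemmas ident_algebra = measurable_joined_algebra_ident[OF indep space_src_algebra]
lemmas ident_algebra_mono = measurable_joined_algebra_mono[OF indep space_src_algebra]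
lemmas decouple = nn_integral_decouple[OF indep space_src_algebra]

lemma measurable_algebra_of:
  assumes "src \<in> A" "A \<subseteq> sources" "X \<in> src_algebra src \<rightarrow>\<^sub>M N"
  shows "X \<in> algebra_of A \<rightarrow>\<^sub>M N"
  using measurable_compose[OF measurable_joined_algebra_component[OF indep space_src_algebra assms(1,2)] assms(3)]
  by simp

text \<open>The observed values \<open>y\<close> are a free argument of \<open>data_of\<close>, so that for fixed \<open>y\<close> the
  evaluated points depend on the design randomness only.\<close>

definition next_point :: "nat \<Rightarrow> 'w \<Rightarrow> 'a data \<Rightarrow> 'a" where
  "next_point t \<omega> d = (case if r (Suc t) \<omega> then C (Suc t) \<omega> else pick t d of (x, i) \<Rightarrow> S (Suc t) x i \<omega>)"

primrec data_of :: "nat \<Rightarrow> 'w \<Rightarrow> (nat \<Rightarrow> real) \<Rightarrow> 'a data" where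
  "data_of 0 \<omega> y = map (\<lambda>j. (s0 j \<omega>, y j)) [0..<n0]"
| "data_of (Suc t) \<omega> y = data_of t \<omega> y @ [(next_point t \<omega> (data_of t \<omega> y), y (n0 + t))]"

definition point :: "nat \<Rightarrow> 'w \<Rightarrow> (nat \<Rightarrow> real) \<Rightarrow> 'a" where
  "point j \<omega> y = (if j < n0 then s0 j \<omega> else next_point (j - n0) \<omega> (data_of (j - n0) \<omega> y))"

text \<open>After \<open>Suc j\<close> trials the list has at least j + 1 entries whatever
  \<open>n0\<close> is, so the index j is always valid.\<close>

definition obs :: "nat \<Rightarrow> 'w \<Rightarrow> real" where
  "obs j \<omega> = snd (run (Suc j) \<omega> ! j)"

lemma data_of_conv_map: "data_of t \<omega> y = map (\<lambda>j. (point j \<omega> y, y j)) [0..<n0 + t]"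
  by (induction t) (auto simp: point_def)

lemma data_of_cong: "(\<And>j. j < n0 + t \<Longrightarrow> y j = y' j) \<Longrightarrow> data_of t \<omega> y = data_of t \<omega> y'"
  by (induction t) auto

text \<open>Nonanticipation: for j >= n0 the list \<open>data_of (j - n0)\<close> reads only values
  with index below n0 + (j - n0) = j, and the initial points read none. This gives the density of
  the observations its triangular form.\<close>

lemma point_cong: "(\<And>i. i < j \<Longrightarrow> y i = y' i) \<Longrightarrow> point j \<omega> y = point j \<omega> y'"
  using data_of_cong[of "j - n0" y y'] by (simp add: point_def)

lemma run_Suc:
  "run (Suc t) \<omega> = run t \<omega> @ [(next_point t \<omega> (run t \<omega>),
     f (next_point t \<omega> (run t \<omega>)) \<omega> + \<rho> (n0 + t) \<omega>)]"
  by (simp add: next_point_def Let_def split: prod.splits)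

declare run_data.simps(2) [simp del]

lemma length_run [simp]: "length (run t \<omega>) = n0 + t"
  by (induction t) (auto simp: run_Suc)

lemma run_nth_stable:
  assumes "j < n0 + t" "t \<le> t'"
  shows "run t' \<omega> ! j = run t \<omega> ! j"
  using assms(2) by (induction t' rule: dec_induct) (use assms(1) in \<open>auto simp: run_Suc nth_append\<close>)

lemma obs_conv_nth: "j < n0 + t \<Longrightarrow> obs j \<omega> = snd (run t \<omega> ! j)"
  using run_nth_stable[of j t "Suc j" \<omega>] run_nth_stable[of j "Suc j" t \<omega>]
  by (cases "t \<le> Suc j") (auto simp: obs_def)

text \<open>Feeding the actual observations into the replay reproduces the run, so statements about
  \<open>data_of\<close> with free values transfer to the run by substitution.\<close>

lemma run_conv_data_of: "run t \<omega> = data_of t \<omega> (\<lambda>j. obs j \<omega>)"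
proof (induction t)
  case 0
  show ?case using obs_conv_nth[of _ 0 \<omega>] by (auto intro!: map_cong)
next
  case (Suc t)
  have "obs (n0 + t) \<omega> = f (next_point t \<omega> (run t \<omega>)) \<omega> + \<rho> (n0 + t) \<omega>"
    using obs_conv_nth[of "n0 + t" "Suc t" \<omega>] by (simp add: run_Suc nth_append)
  then show ?case by (simp add: run_Suc Suc.IH)
qed

lemma obs_rec: "obs j \<omega> = f (point j \<omega> (\<lambda>i. obs i \<omega>)) \<omega> + \<rho> j \<omega>"
proof (cases "j < n0")
  case True
  then show ?thesis using obs_conv_nth[of j 0 \<omega>] by (simp add: point_def)
next
  case False
  then have "obs (n0 + (j - n0)) \<omega> = f (next_point (j - n0) \<omega> (run (j - n0) \<omega>)) \<omega> + \<rho> (n0 + (j - n0)) \<omega>"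
    using obs_conv_nth[of "n0 + (j - n0)" "Suc (j - n0)" \<omega>] by (simp add: run_Suc nth_append)
  with False show ?thesis by (simp add: point_def run_conv_data_of)
qed

text \<open>The run only appends, so its whole history can be read off the current list as
  prefixes.\<close>

lemma take_run:
  assumes "t' \<le> t"
  shows "take (n0 + t') (run t \<omega>) = run t' \<omega>"
  using assms by (intro nth_equalityI) (auto simp: run_nth_stable[symmetric])

section \<open>Measurability of the evaluated points and of the observations\<close>

lemma measurable_s0: "j < n0 \<Longrightarrow> s0 j \<in> algebra_of design \<rightarrow>\<^sub>M restrict_space borel D"
  by (intro measurable_restrict_space2 measurable_algebra_of[where src=Init])
     (auto simp: design_subset source_algebra_def init intro!: measurable_generated_by, auto simp: design_def)

lemma measurable_r: "r (Suc t) \<in> algebra_of design \<rightarrow>\<^sub>M count_space UNIV"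
  by (intro measurable_algebra_of[where src="Bern (Suc t)"])
     (auto simp: design_subset source_algebra_def intro!: measurable_generated_by, auto simp: design_def)

lemma measurable_C: "C (Suc t) \<in> algebra_of design \<rightarrow>\<^sub>M count_space (\<Omega> \<times> {1..K})"
  using cand[of "Suc t"]
  by (intro measurable_algebra_of[where src="Cand (Suc t)"])
     (auto simp: design_subset source_algebra_def intro!: measurable_generated_by, auto simp: design_def)

lemma measurable_S:
  assumes "q \<in> \<Omega> \<times> {1..K}"
  shows "S (Suc t) (fst q) (snd q) \<in> algebra_of design \<rightarrow>\<^sub>M restrict_space borel D"
proof -
  have "(\<lambda>(x, i). S (Suc t) x i) q
      \<in> generated_by M (\<Omega> \<times> {1..K}) (\<lambda>(x, i). S (Suc t) x i) borel \<rightarrow>\<^sub>M borel"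
    by (rule measurable_generated_by[OF assms]) auto
  then have "S (Suc t) (fst q) (snd q) \<in> algebra_of design \<rightarrow>\<^sub>M borel"
    by (intro measurable_algebra_of[where src="Input (Suc t)"])
       (auto simp: design_subset source_algebra_def case_prod_beta', auto simp: design_def)
  then show ?thesis
    using assms input[of "Suc t"] by (intro measurable_restrict_space2) auto
qed

lemma measurable_rho: "\<rho> j \<in> borel_measurable (algebra_of {Noise j})"
  by (intro measurable_algebra_of[where src="Noise j"])
     (auto simp: design_subset source_algebra_def intro!: measurable_generated_by)

lemma measurable_ident_Fun: "Fun \<in> A \<Longrightarrow> A \<subseteq> sources \<Longrightarrow> (\<lambda>\<omega>. \<omega>) \<in> algebra_of A \<rightarrow>\<^sub>M generated_by M D f borel"
  using measurable_joined_algebra_component[OF indep space_src_algebra, of Fun A]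
  unfolding src_algebra_Fun .

text \<open>W and Y are left general so that the values may be constants, coordinates of a product
  space, or the actual observations. The induction is over all smaller indices because
  \<open>pick\<close> is fed with every earlier point.\<close>

lemma measurable_point:
  fixes N :: "'b measure"
  assumes W: "W \<in> N \<rightarrow>\<^sub>M algebra_of design" and Y: "\<And>i. i < j \<Longrightarrow> Y i \<in> borel_measurable N"
  shows "(\<lambda>w. point j (W w) (\<lambda>i. Y i w)) \<in> N \<rightarrow>\<^sub>M restrict_space borel D"
  using Y
proof (induction j rule: less_induct)
  case (less j)
  show ?case
  proof (cases "j < n0")
    case True
    then show ?thesis
      using measurable_compose[OF W measurable_s0[OF True]] by (simp add: point_def)
  next
    case False
    define t where "t = j - n0"
    have j: "j = n0 + t" using False by (simp add: t_def)
    define z where "z w = (\<lambda>i\<in>{..<n0 + t}. (point i (W w) (\<lambda>i. Y i w), Y i w))" for w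
    have "(\<lambda>w. (point i (W w) (\<lambda>i. Y i w), Y i w)) \<in> borel_measurable N" if "i < j" for i
    proof -
      have "(\<lambda>w. point i (W w) (\<lambda>i. Y i w)) \<in> borel_measurable N"
        using less.IH[OF that] less.prems that by (auto simp: measurable_restrict_space2_iff)
      then show ?thesis using less.prems[OF that] by (rule borel_measurable_Pair)
    qed
    then have z: "z \<in> N \<rightarrow>\<^sub>M PiM {..<n0 + t} (\<lambda>_. borel)"
      unfolding z_def by (intro measurable_restrict) (simp add: j)
    have data: "data_of t (W w) (\<lambda>i. Y i w) = map (z w) [0..<n0 + t]" for w
      unfolding data_of_conv_map z_def by (intro map_cong) auto
    have sel: "(\<lambda>w. if r (Suc t) (W w) then C (Suc t) (W w) else pick t (data_of t (W w) (\<lambda>i. Y i w)))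
        \<in> N \<rightarrow>\<^sub>M count_space (\<Omega> \<times> {1..K})"
      unfolding data
      using measurable_compose[OF W measurable_r] measurable_compose[OF W measurable_C] measurable_compose[OF z pick]
      by (intro measurable_If) auto
    have S: "(\<lambda>w. S (Suc t) (fst q) (snd q) (W w)) \<in> N \<rightarrow>\<^sub>M restrict_space borel D" if "q \<in> \<Omega> \<times> {1..K}" for q
      by (rule measurable_compose[OF W measurable_S[OF that]])
    \<comment> \<open>The request takes finitely many values, so the family S, itself indexed by the
      request, can be handled one request at a time.\<close>
    have "(\<lambda>w. (\<lambda>q w. S (Suc t) (fst q) (snd q) (W w))
          (if r (Suc t) (W w) then C (Suc t) (W w) else pick t (data_of t (W w) (\<lambda>i. Y i w))) w)
        \<in> N \<rightarrow>\<^sub>M restrict_space borel D"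
      by (rule measurable_compose_countable'[OF S sel]) (use \<Omega> in \<open>auto intro: countable_finite\<close>)
    then show ?thesis
      by (simp add: point_def j next_point_def case_prod_beta')
  qed
qed

lemma measurable_f_point:
  fixes N :: "'b measure"
  assumes "V \<in> N \<rightarrow>\<^sub>M generated_by M D f borel" "W \<in> N \<rightarrow>\<^sub>M algebra_of design"
    "\<And>i. i < j \<Longrightarrow> Y i \<in> borel_measurable N"
  shows "(\<lambda>w. f (point j (W w) (\<lambda>i. Y i w)) (V w)) \<in> borel_measurable N"
  using assms by (intro measurable_f_comp measurable_point) auto

text \<open>Observation j involves the noise only up to index j. Hence the noise with index n stays
  outside this algebra and is independent of the first n observations.\<close>

lemma measurable_obs: "j < n \<Longrightarrow> obs j \<in> borel_measurable (algebra_of (insert Fun design \<union> Noise ` {..<n}))"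
proof (induction j rule: less_induct)
  case (less j)
  let ?A = "algebra_of (insert Fun design \<union> Noise ` {..<n})"
  have "(\<lambda>\<omega>. f (point j \<omega> (\<lambda>i. obs i \<omega>)) \<omega>) \<in> borel_measurable ?A"
    using less by (intro measurable_f_point measurable_ident_Fun ident_algebra_mono) (auto simp: design_subset)
  moreover have "\<rho> j \<in> borel_measurable ?A"
    using measurable_compose[OF ident_algebra_mono[of "{Noise j}" "insert Fun design \<union> Noise ` {..<n}"] measurable_rho]
      less.prems by (auto simp: design_subset)
  ultimately have "(\<lambda>\<omega>. f (point j \<omega> (\<lambda>i. obs i \<omega>)) \<omega> + \<rho> j \<omega>) \<in> borel_measurable ?A"
    by (rule borel_measurable_add)
  then show ?case by (simp add: obs_rec[symmetric])
qed

lemma measurable_obs_M: "obs j \<in> borel_measurable M"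
  using measurable_compose[OF ident_algebra measurable_obs[of j "Suc j"]] by (auto simp: design_subset)

text \<open>Two sample points are kept apart: \<omega>1 drives f and \<omega>2 the design. On the
  diagonal this is the density of the observations; off the diagonal it is the form that arises once
  f is decoupled from the design.\<close>

definition density_of :: "nat \<Rightarrow> 'w \<Rightarrow> 'w \<Rightarrow> (nat \<Rightarrow> real) \<Rightarrow> real" where
  "density_of n \<omega>1 \<omega>2 y = (\<Prod>j<n. normal_density (f (point j \<omega>2 y) \<omega>1) \<sigma> (y j))"

lemma density_of_nonneg: "0 \<le> density_of n \<omega>1 \<omega>2 y"
  by (auto simp: density_of_def intro!: prod_nonneg)

text \<open>By \<open>point_cong\<close> neither the earlier factors nor the point with index n see
  the last value, so one more observation contributes exactly one conditional density.\<close>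

lemma density_of_Suc:
  "density_of (Suc n) \<omega>1 \<omega>2 (y(n := v)) = density_of n \<omega>1 \<omega>2 y * normal_density (f (point n \<omega>2 y) \<omega>1) \<sigma> v"
proof -
  have "point j \<omega>2 (y(n := v)) = point j \<omega>2 y" if "j \<le> n" for j
    using that by (intro point_cong) auto
  then show ?thesis by (simp add: density_of_def)
qed

lemma density_of_conv_likelihood: "density_of (n0 + t) \<omega>1 \<omega>2 y = likelihood f \<sigma> (data_of t \<omega>2 y) \<omega>1"
  by (auto simp: density_of_def likelihood_def data_of_conv_map intro!: prod.cong)

lemma measurable_density_of:
  fixes N :: "'b measure"
  assumes "V \<in> N \<rightarrow>\<^sub>M generated_by M D f borel" "W \<in> N \<rightarrow>\<^sub>M algebra_of design"
    "\<And>i. i < n \<Longrightarrow> (\<lambda>w. Y w i) \<in> borel_measurable N"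
  shows "(\<lambda>w. density_of n (V w) (W w) (Y w)) \<in> borel_measurable N"
proof -
  have "(\<lambda>w. normal_density (f (point j (W w) (Y w)) (V w)) \<sigma> (Y w j)) \<in> borel_measurable N" if "j < n" for j
  proof -
    have [measurable]: "(\<lambda>w. f (point j (W w) (Y w)) (V w)) \<in> borel_measurable N" "(\<lambda>w. Y w j) \<in> borel_measurable N"
      using measurable_f_point[OF assms(1,2), of j "\<lambda>i w. Y w i"] assms(3) that by auto
    show ?thesis unfolding normal_density_def by measurable
  qed
  then show ?thesis unfolding density_of_def by (intro borel_measurable_prod) auto
qed

end

lemma measurable_PiM_lborel_upd:
  assumes "U \<in> N \<rightarrow>\<^sub>M PiM {..<n} (\<lambda>_. lborel :: real measure)" "v \<in> borel_measurable N"
  shows "(\<lambda>w. (U w)(n := v w)) \<in> N \<rightarrow>\<^sub>M PiM {..<Suc n} (\<lambda>_. lborel :: real measure)"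
proof -
  have "(\<lambda>w. (U w, v w)) \<in> N \<rightarrow>\<^sub>M PiM {..<n} (\<lambda>_. lborel) \<Otimes>\<^sub>M lborel"
    using assms by (intro measurable_Pair) auto
  from measurable_compose[OF this measurable_add_dim[of n "{..<n}" "\<lambda>_. lborel"]]
  show ?thesis by (simp add: lessThan_Suc)
qed

lemma measurable_PiM_lborel_component:
  "i < n \<Longrightarrow> (\<lambda>y. y i) \<in> borel_measurable (PiM {..<n} (\<lambda>_. lborel :: real measure))"
  using measurable_component_singleton[of i "{..<n}" "\<lambda>_. lborel :: real measure"] by simp

section \<open>The law of the observation vector\<close>

context classification_run
begin

abbreviation obs_vec :: "nat \<Rightarrow> 'w \<Rightarrow> nat \<Rightarrow> real" where
  "obs_vec n \<omega> \<equiv> \<lambda>j\<in>{..<n}. obs j \<omega>"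

lemma measurable_obs_vec: "obs_vec n \<in> algebra_of (insert Fun design \<union> Noise ` {..<n}) \<rightarrow>\<^sub>M \<Lambda> n"
  by (intro measurable_restrict) (simp del: Un_insert_left add: measurable_obs)

lemma obs_vec_Suc:
  "obs_vec (Suc n) \<omega> = (obs_vec n \<omega>)(n := f (point n \<omega> (obs_vec n \<omega>)) \<omega> + \<rho> n \<omega>)"
proof -
  have "point n \<omega> (obs_vec n \<omega>) = point n \<omega> (\<lambda>i. obs i \<omega>)"
    by (intro point_cong) auto
  then show ?thesis by (auto simp: fun_eq_iff obs_rec[of n \<omega>, symmetric] less_Suc_eq)
qed

lemma sigma_finite_\<Lambda>: "sigma_finite_measure (\<Lambda> n)"
proof -
  interpret finite_product_sigma_finite "\<lambda>_::nat. lborel :: real measure" "{..<n}" by unfold_locales simp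
  show ?thesis by unfold_locales
qed

lemma nn_integral_normal_shift:
  assumes F: "F \<in> borel_measurable borel"
  shows "(\<integral>\<^sup>+\<omega>. F (m + \<rho> n \<omega>) \<partial>M) = (\<integral>\<^sup>+v. ennreal (normal_density m \<sigma> v) * F v \<partial>lborel)"
proof -
  have [measurable]: "(\<lambda>e. F (m + e)) \<in> borel_measurable borel"
    by (rule measurable_compose[OF _ F]) measurable
  have "(\<integral>\<^sup>+\<omega>. F (m + \<rho> n \<omega>) \<partial>M) = (\<integral>\<^sup>+e. ennreal (normal_density 0 \<sigma> e) * F (m + e) \<partial>lborel)"
    by (rule distributed_nn_integral[OF noise, symmetric]) simp
  also have "\<dots> = (\<integral>\<^sup>+v. ennreal (normal_density 0 \<sigma> (- m + 1 * v)) * F (m + (- m + 1 * v)) \<partial>lborel)"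
    by (subst nn_integral_real_affine[where c=1 and t="- m"]) auto
  also have "\<dots> = (\<integral>\<^sup>+v. ennreal (normal_density m \<sigma> v) * F v \<partial>lborel)"
    by (simp add: normal_density_def)
  finally show ?thesis .
qed

text \<open>Adaptivity is harmless: although each point depends on earlier observations, the density of
  the observation vector is the product of the noise densities, as for a fixed design.\<close>

lemma nn_integral_obs_vec:
  assumes "\<Phi> \<in> borel_measurable (algebra_of (insert Fun design) \<Otimes>\<^sub>M \<Lambda> n)"
  shows "(\<integral>\<^sup>+\<omega>. \<Phi> (\<omega>, obs_vec n \<omega>) \<partial>M)
    = (\<integral>\<^sup>+\<omega>. \<integral>\<^sup>+y. \<Phi> (\<omega>, y) * ennreal (density_of n \<omega> \<omega> y) \<partial>\<Lambda> n \<partial>M)"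
  using assms
proof (induction n arbitrary: \<Phi>)
  case 0
  interpret product_sigma_finite "\<lambda>_::nat. lborel :: real measure" by unfold_locales
  show ?case
    by (simp add: nn_integral_empty density_of_def restrict_def)
next
  case (Suc n)
  note \<Phi> = Suc.prems
  let ?H = "algebra_of (insert Fun design)"
  let ?HN = "algebra_of (insert Fun design \<union> Noise ` {..<n})"
  let ?c = "\<lambda>\<omega> y. f (point n \<omega> y) \<omega>"
  interpret P: product_sigma_finite "\<lambda>_::nat. lborel :: real measure" by unfold_locales
  have H_Fun: "(\<lambda>\<omega>. \<omega>) \<in> ?H \<rightarrow>\<^sub>M generated_by M D f borel"
    by (rule measurable_ident_Fun) (auto simp: design_subset)
  have H_design: "(\<lambda>\<omega>. \<omega>) \<in> ?H \<rightarrow>\<^sub>M algebra_of design"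
    by (rule ident_algebra_mono) (auto simp: design_subset)
  have HN_H: "(\<lambda>\<omega>. \<omega>) \<in> ?HN \<rightarrow>\<^sub>M ?H"
    by (rule ident_algebra_mono) (auto simp: design_subset)
  have c: "(\<lambda>p. ?c (fst p) (snd p)) \<in> borel_measurable (?H \<Otimes>\<^sub>M \<Lambda> n)"
    by (intro measurable_f_point[where Y="\<lambda>i p. snd p i"] measurable_compose[OF measurable_fst H_Fun]
        measurable_compose[OF measurable_fst H_design] measurable_compose[OF measurable_snd]
        measurable_PiM_lborel_component)
  have ext: "(\<lambda>w. \<Phi> (U w, (Y w)(n := v w))) \<in> borel_measurable N"
    if "U \<in> N \<rightarrow>\<^sub>M ?H" "Y \<in> N \<rightarrow>\<^sub>M \<Lambda> n" "v \<in> borel_measurable N" for U Y v and N :: "'c measure"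
    using that by (intro measurable_compose[OF measurable_Pair \<Phi>] measurable_PiM_lborel_upd)
  \<comment> \<open>The last observation is integrated out against its conditional density given
    everything before it; what is left depends on n observations and is accessible to the induction
    hypothesis.\<close>
  define \<Phi>' where "\<Phi>' = (\<lambda>(\<omega>, y). \<integral>\<^sup>+v. ennreal (normal_density (?c \<omega> y) \<sigma> v) * \<Phi> (\<omega>, y(n := v)) \<partial>lborel)"
  have \<Phi>': "\<Phi>' \<in> borel_measurable (?H \<Otimes>\<^sub>M \<Lambda> n)"
  proof -
    have "(\<lambda>q. \<Phi> (fst (fst q), (snd (fst q))(n := snd q))) \<in> borel_measurable ((?H \<Otimes>\<^sub>M \<Lambda> n) \<Otimes>\<^sub>M lborel)"
      by (intro ext measurable_compose[OF measurable_fst measurable_fst]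
          measurable_compose[OF measurable_fst measurable_snd]) simp
    moreover have "(\<lambda>q. normal_density (?c (fst (fst q)) (snd (fst q))) \<sigma> (snd q))
        \<in> borel_measurable ((?H \<Otimes>\<^sub>M \<Lambda> n) \<Otimes>\<^sub>M lborel)"
    proof -
      have [measurable]: "(\<lambda>q. ?c (fst (fst q)) (snd (fst q))) \<in> borel_measurable ((?H \<Otimes>\<^sub>M \<Lambda> n) \<Otimes>\<^sub>M lborel)"
        by (rule measurable_compose[OF measurable_fst c])
      show ?thesis unfolding normal_density_def by measurable
    qed
    ultimately show ?thesis
      unfolding \<Phi>'_def case_prod_beta'
      by (intro lborel.borel_measurable_nn_integral) (simp add: case_prod_beta')
  qed
  \<comment> \<open>The newest noise is detached as the second argument. Everything else, the first
    n observations included, lives on the first argument, whose algebra does not contain that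
    noise.\<close>
  define \<Psi> where "\<Psi> = (\<lambda>(\<omega>1, \<omega>2). \<Phi> (\<omega>1, (obs_vec n \<omega>1)(n := ?c \<omega>1 (obs_vec n \<omega>1) + \<rho> n \<omega>2)))"
  have c_obs: "(\<lambda>\<omega>. ?c \<omega> (obs_vec n \<omega>)) \<in> borel_measurable ?HN"
    using measurable_compose[OF measurable_Pair[OF HN_H measurable_obs_vec] c] by simp
  have \<Psi>: "\<Psi> \<in> borel_measurable (?HN \<Otimes>\<^sub>M algebra_of {Noise n})"
    unfolding \<Psi>_def case_prod_beta'
    by (intro ext measurable_compose[OF measurable_fst HN_H] measurable_compose[OF measurable_fst measurable_obs_vec]
        borel_measurable_add measurable_compose[OF measurable_fst c_obs] measurable_compose[OF measurable_snd measurable_rho])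
  have "(\<integral>\<^sup>+\<omega>. \<Phi> (\<omega>, obs_vec (Suc n) \<omega>) \<partial>M) = (\<integral>\<^sup>+\<omega>. \<Psi> (\<omega>, \<omega>) \<partial>M)"
    unfolding \<Psi>_def obs_vec_Suc by simp
  also have "\<dots> = (\<integral>\<^sup>+\<omega>1. \<integral>\<^sup>+\<omega>2. \<Psi> (\<omega>1, \<omega>2) \<partial>M \<partial>M)"
    using \<Psi> by (intro decouple) (auto simp: design_subset)
  also have "\<dots> = (\<integral>\<^sup>+\<omega>. \<Phi>' (\<omega>, obs_vec n \<omega>) \<partial>M)"
  proof (intro nn_integral_cong)
    fix \<omega> assume \<omega>: "\<omega> \<in> space M"
    have "obs_vec n \<omega> \<in> space (\<Lambda> n)" by (simp add: space_PiM)
    then have "(\<lambda>v. \<Phi> (\<omega>, (obs_vec n \<omega>)(n := v))) \<in> borel_measurable borel"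
      using \<omega> by (intro ext measurable_const) auto
    from nn_integral_normal_shift[OF this, of "?c \<omega> (obs_vec n \<omega>)" n]
    show "(\<integral>\<^sup>+\<omega>2. \<Psi> (\<omega>, \<omega>2) \<partial>M) = \<Phi>' (\<omega>, obs_vec n \<omega>)"
      by (simp add: \<Psi>_def \<Phi>'_def)
  qed
  also have "\<dots> = (\<integral>\<^sup>+\<omega>. \<integral>\<^sup>+y. \<Phi>' (\<omega>, y) * ennreal (density_of n \<omega> \<omega> y) \<partial>\<Lambda> n \<partial>M)"
    by (rule Suc.IH[OF \<Phi>'])
  also have "\<dots> = (\<integral>\<^sup>+\<omega>. \<integral>\<^sup>+y. \<Phi> (\<omega>, y) * ennreal (density_of (Suc n) \<omega> \<omega> y) \<partial>\<Lambda> (Suc n) \<partial>M)"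
  proof (intro nn_integral_cong)
    fix \<omega> assume \<omega>: "\<omega> \<in> space M"
    then have \<omega>H: "\<omega> \<in> space ?H" by simp
    have "(\<lambda>y. \<Phi> (\<omega>, y)) \<in> borel_measurable (\<Lambda> (Suc n))"
      by (rule measurable_compose[OF measurable_Pair1'[OF \<omega>H] \<Phi>])
    moreover have "density_of (Suc n) \<omega> \<omega> \<in> borel_measurable (\<Lambda> (Suc n))"
      using \<omega>
      by (intro measurable_density_of[where V="\<lambda>_. \<omega>" and W="\<lambda>_. \<omega>" and Y="\<lambda>y. y"] measurable_const
          measurable_PiM_lborel_component) auto
    ultimately have meas: "(\<lambda>y. \<Phi> (\<omega>, y) * ennreal (density_of (Suc n) \<omega> \<omega> y)) \<in> borel_measurable (\<Lambda> (Suc n))"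
      by measurable
    have "(\<integral>\<^sup>+y. \<Phi> (\<omega>, y) * ennreal (density_of (Suc n) \<omega> \<omega> y) \<partial>\<Lambda> (Suc n))
        = (\<integral>\<^sup>+y. \<integral>\<^sup>+v. \<Phi> (\<omega>, y(n := v)) * ennreal (density_of (Suc n) \<omega> \<omega> (y(n := v))) \<partial>lborel \<partial>\<Lambda> n)"
      unfolding lessThan_Suc using meas by (intro P.product_nn_integral_insert) (auto simp: lessThan_Suc)
    also have "\<dots> = (\<integral>\<^sup>+y. \<Phi>' (\<omega>, y) * ennreal (density_of n \<omega> \<omega> y) \<partial>\<Lambda> n)"
    proof (intro nn_integral_cong)
      fix y assume y: "y \<in> space (\<Lambda> n)"
      have [measurable]: "(\<lambda>v. \<Phi> (\<omega>, y(n := v))) \<in> borel_measurable borel"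
        using \<omega> y by (intro ext measurable_const) auto
      have "\<Phi> (\<omega>, y(n := v)) * ennreal (density_of (Suc n) \<omega> \<omega> (y(n := v)))
          = (ennreal (normal_density (?c \<omega> y) \<sigma> v) * \<Phi> (\<omega>, y(n := v))) * ennreal (density_of n \<omega> \<omega> y)" for v
        by (simp add: density_of_Suc ennreal_mult density_of_nonneg mult_ac)
      then show "(\<integral>\<^sup>+v. \<Phi> (\<omega>, y(n := v)) * ennreal (density_of (Suc n) \<omega> \<omega> (y(n := v))) \<partial>lborel)
          = \<Phi>' (\<omega>, y) * ennreal (density_of n \<omega> \<omega> y)"
        by (simp add: \<Phi>'_def nn_integral_multc)
    qed
    finally show "(\<integral>\<^sup>+y. \<Phi>' (\<omega>, y) * ennreal (density_of n \<omega> \<omega> y) \<partial>\<Lambda> n)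
        = (\<integral>\<^sup>+y. \<Phi> (\<omega>, y) * ennreal (density_of (Suc n) \<omega> \<omega> y) \<partial>\<Lambda> (Suc n))" ..
  qed
  finally show ?case .
qed

text \<open>The observations mix f with the design, so the two can be decoupled only after
  \<open>nn_integral_obs_vec\<close> has turned the observations into an integration variable y.
  Then f and the design are independent sources, and Tonelli puts the integral over f
  innermost.\<close>

lemma nn_integral_obs_vec_freeze:
  assumes G: "G \<in> borel_measurable ((algebra_of design \<Otimes>\<^sub>M algebra_of {Fun}) \<Otimes>\<^sub>M \<Lambda> n)"
  shows "(\<integral>\<^sup>+\<omega>. G ((\<omega>, \<omega>), obs_vec n \<omega>) \<partial>M)
    = (\<integral>\<^sup>+\<omega>2. \<integral>\<^sup>+y. \<integral>\<^sup>+\<omega>1. G ((\<omega>2, \<omega>1), y) * ennreal (density_of n \<omega>1 \<omega>2 y) \<partial>M \<partial>\<Lambda> n \<partial>M)"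
proof -
  let ?H = "algebra_of (insert Fun design)"
  let ?G' = "\<lambda>q. G q * ennreal (density_of n (snd (fst q)) (fst (fst q)) (snd q))"
  interpret \<Lambda>: sigma_finite_measure "\<Lambda> n" by (rule sigma_finite_\<Lambda>)
  interpret Q: pair_sigma_finite M "\<Lambda> n" by unfold_locales
  have H_Fun: "(\<lambda>\<omega>. \<omega>) \<in> ?H \<rightarrow>\<^sub>M algebra_of {Fun}"
    by (rule ident_algebra_mono) (auto simp: design_subset)
  have H_design: "(\<lambda>\<omega>. \<omega>) \<in> ?H \<rightarrow>\<^sub>M algebra_of design"
    by (rule ident_algebra_mono) (auto simp: design_subset)
  have Fun: "(\<lambda>\<omega>. \<omega>) \<in> algebra_of {Fun} \<rightarrow>\<^sub>M generated_by M D f borel"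
    by (rule measurable_ident_Fun) auto
  have M_Fun: "(\<lambda>\<omega>. \<omega>) \<in> M \<rightarrow>\<^sub>M algebra_of {Fun}"
    by (rule ident_algebra) auto
  have \<Phi>: "(\<lambda>p. G ((fst p, fst p), snd p)) \<in> borel_measurable (?H \<Otimes>\<^sub>M \<Lambda> n)"
    by (intro measurable_compose[OF _ G] measurable_Pair measurable_compose[OF measurable_fst H_Fun]
        measurable_compose[OF measurable_fst H_design] measurable_snd)
  have "(\<lambda>q. density_of n (snd (fst q)) (fst (fst q)) (snd q))
      \<in> borel_measurable ((algebra_of design \<Otimes>\<^sub>M algebra_of {Fun}) \<Otimes>\<^sub>M \<Lambda> n)"
    by (intro measurable_density_of measurable_compose[OF measurable_compose[OF measurable_fst measurable_snd] Fun]
        measurable_compose[OF measurable_fst measurable_fst] measurable_compose[OF measurable_snd]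
        measurable_PiM_lborel_component)
  then have G': "?G' \<in> borel_measurable ((algebra_of design \<Otimes>\<^sub>M algebra_of {Fun}) \<Otimes>\<^sub>M \<Lambda> n)"
    using G by (intro borel_measurable_times_ennreal measurable_compose[OF _ measurable_ennreal])
  have \<Psi>: "(\<lambda>p. \<integral>\<^sup>+y. ?G' (p, y) \<partial>\<Lambda> n) \<in> borel_measurable (algebra_of design \<Otimes>\<^sub>M algebra_of {Fun})"
    using G' by (intro \<Lambda>.borel_measurable_nn_integral) (simp add: case_prod_beta')
  have "(\<integral>\<^sup>+\<omega>. G ((\<omega>, \<omega>), obs_vec n \<omega>) \<partial>M) = (\<integral>\<^sup>+\<omega>. \<integral>\<^sup>+y. ?G' ((\<omega>, \<omega>), y) \<partial>\<Lambda> n \<partial>M)"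
    using nn_integral_obs_vec[OF \<Phi>] by simp
  also have "\<dots> = (\<integral>\<^sup>+\<omega>2. \<integral>\<^sup>+\<omega>1. \<integral>\<^sup>+y. ?G' ((\<omega>2, \<omega>1), y) \<partial>\<Lambda> n \<partial>M \<partial>M)"
    using decouple[OF _ _ _ \<Psi>] by (simp add: design_subset)
  also have "\<dots> = (\<integral>\<^sup>+\<omega>2. \<integral>\<^sup>+y. \<integral>\<^sup>+\<omega>1. ?G' ((\<omega>2, \<omega>1), y) \<partial>M \<partial>\<Lambda> n \<partial>M)"
  proof (intro nn_integral_cong Q.Fubini'[symmetric])
    fix \<omega>2 assume "\<omega>2 \<in> space M"
    then have "(\<lambda>q. ?G' ((\<omega>2, fst q), snd q)) \<in> borel_measurable (M \<Otimes>\<^sub>M \<Lambda> n)"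
      by (intro measurable_compose[OF _ G'] measurable_Pair measurable_const measurable_snd
          measurable_compose[OF measurable_fst M_Fun]) auto
    then show "(\<lambda>(\<omega>1, y). ?G' ((\<omega>2, \<omega>1), y)) \<in> borel_measurable (M \<Otimes>\<^sub>M \<Lambda> n)"
      by (simp add: case_prod_beta')
  qed
  finally show ?thesis by simp
qed

text \<open>Membership in D is read off the codomain in \<open>measurable_point\<close>, taken with
  constant observation values.\<close>

lemma data_points: "\<omega> \<in> space M \<Longrightarrow> fst ` set (data_of t \<omega> y) \<subseteq> D"
proof -
  assume \<omega>: "\<omega> \<in> space M"
  have "point j \<omega> y \<in> D" for j
  proof -
    have "(\<lambda>\<omega>. point j \<omega> y) \<in> algebra_of design \<rightarrow>\<^sub>M restrict_space borel D"
      using measurable_point[where W="\<lambda>\<omega>. \<omega>" and N="algebra_of design" and Y="\<lambda>i _. y i" and j=j] by simp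
    from measurable_space[OF this, of \<omega>] \<omega> show ?thesis by (simp add: space_restrict_space)
  qed
  then show ?thesis by (auto simp: data_of_conv_map)
qed

lemma run_conv_obs_vec: "run t \<omega> = data_of t \<omega> (obs_vec (n0 + t) \<omega>)"
  unfolding run_conv_data_of by (rule data_of_cong) auto

section \<open>The posterior tail bound along a run\<close>

definition miss :: "real \<Rightarrow> 'a \<Rightarrow> 'a data \<Rightarrow> 'w \<Rightarrow> bool" where
  "miss \<beta> x d \<omega> \<longleftrightarrow> sqrt \<beta> * sqrt (post_var k \<sigma> d x) < \<bar>f x \<omega> - post_mean k \<sigma> d x\<bar>"

lemma measurable_f_Fun: "x \<in> D \<Longrightarrow> f x \<in> borel_measurable (algebra_of {Fun})"
  by (intro measurable_algebra_of[where src=Fun]) (auto simp: src_algebra_Fun intro!: measurable_generated_by)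

text \<open>Once the design and y are frozen, P is a constant: either the integrand vanishes or
  \<open>posterior_tail\<close> applies to the inner integral. Keeping the probability of P as a
  factor is essential, since the bound is later summed over all times.\<close>

proposition posterior_tail_run:
  assumes x: "x \<in> D" and \<beta>: "0 \<le> \<beta>"
    and P: "Measurable.pred (algebra_of design \<Otimes>\<^sub>M \<Lambda> (n0 + t)) (\<lambda>p. P (data_of t (fst p) (snd p)))"
  shows "emeasure M {\<omega> \<in> space M. P (run t \<omega>) \<and> miss \<beta> x (run t \<omega>) \<omega>}
    \<le> ennreal (exp (- \<beta> / 2)) * emeasure M {\<omega> \<in> space M. P (run t \<omega>)}"
proof -
  let ?n = "n0 + t"
  let ?N = "(algebra_of design \<Otimes>\<^sub>M algebra_of {Fun}) \<Otimes>\<^sub>M \<Lambda> ?n"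
  let ?d = "\<lambda>q. data_of t (fst (fst q)) (snd q)"
  have design: "(\<lambda>q. fst (fst q)) \<in> ?N \<rightarrow>\<^sub>M algebra_of design"
    by (rule measurable_compose[OF measurable_fst measurable_fst])
  have y: "(\<lambda>q. snd q i) \<in> borel_measurable ?N" if "i < ?n" for i
    by (intro measurable_compose[OF measurable_snd measurable_PiM_lborel_component] that)
  have Pm[measurable]: "Measurable.pred ?N (\<lambda>q. P (?d q))"
    using measurable_compose[OF measurable_Pair[OF design measurable_snd] P] by simp
  have pts: "(\<lambda>q. point j (fst (fst q)) (snd q)) \<in> ?N \<rightarrow>\<^sub>M restrict_space borel D" if "j < ?n" for j
    using measurable_point[OF design, of j "\<lambda>i q. snd q i"] y that by simp
  have [measurable]: "(\<lambda>q. post_mean k \<sigma> (?d q) x) \<in> borel_measurable ?N"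
    unfolding data_of_conv_map by (intro borel_measurable_post_mean pts y \<sigma> x)
  have [measurable]: "(\<lambda>q. post_var k \<sigma> (?d q) x) \<in> borel_measurable ?N"
    unfolding data_of_conv_map by (intro borel_measurable_post_var pts y \<sigma> x)
  have [measurable]: "(\<lambda>q. f x (snd (fst q))) \<in> borel_measurable ?N"
    by (rule measurable_compose[OF measurable_compose[OF measurable_fst measurable_snd] measurable_f_Fun[OF x]])
  have Pmiss[measurable]: "Measurable.pred ?N (\<lambda>q. P (?d q) \<and> miss \<beta> x (?d q) (snd (fst q)))"
    unfolding miss_def by measurable
  let ?I = "\<lambda>q. indicator {q. P (?d q)} q :: ennreal"
  let ?G = "\<lambda>q. indicator {q. P (?d q) \<and> miss \<beta> x (?d q) (snd (fst q))} q :: ennreal"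
  have G0: "?I \<in> borel_measurable ?N"
    by measurable
  have G: "?G \<in> borel_measurable ?N"
    by measurable
  have M_N: "(\<lambda>\<omega>. ((\<omega>, \<omega>), obs_vec ?n \<omega>)) \<in> M \<rightarrow>\<^sub>M ?N"
    by (intro measurable_Pair ident_algebra measurable_restrict) (auto simp: design_subset measurable_obs_M)
  have eq: "emeasure M {\<omega> \<in> space M. R ((\<omega>, \<omega>), obs_vec ?n \<omega>)}
      = (\<integral>\<^sup>+\<omega>. indicator {q. R q} ((\<omega>, \<omega>), obs_vec ?n \<omega>) \<partial>M)"
    if "Measurable.pred ?N R" for R
  proof -
    have "{\<omega> \<in> space M. R ((\<omega>, \<omega>), obs_vec ?n \<omega>)} \<in> sets M"
      using measurable_compose[OF M_N that] by (simp add: pred_def)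
    then have "emeasure M {\<omega> \<in> space M. R ((\<omega>, \<omega>), obs_vec ?n \<omega>)}
        = (\<integral>\<^sup>+\<omega>. indicator {\<omega> \<in> space M. R ((\<omega>, \<omega>), obs_vec ?n \<omega>)} \<omega> \<partial>M)" by simp
    also have "\<dots> = (\<integral>\<^sup>+\<omega>. indicator {q. R q} ((\<omega>, \<omega>), obs_vec ?n \<omega>) \<partial>M)"
      by (intro nn_integral_cong) (auto simp: indicator_def)
    finally show ?thesis .
  qed
  let ?c = "ennreal (exp (- \<beta> / 2))"
  have inner: "(\<integral>\<^sup>+\<omega>1. ?G ((\<omega>2, \<omega>1), y) * ennreal (density_of ?n \<omega>1 \<omega>2 y) \<partial>M)
      \<le> (\<integral>\<^sup>+\<omega>1. (?c * ?I ((\<omega>2, \<omega>1), y)) * ennreal (density_of ?n \<omega>1 \<omega>2 y) \<partial>M)"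
    if \<omega>2: "\<omega>2 \<in> space M" for \<omega>2 y
  proof (cases "P (data_of t \<omega>2 y)")
    case True
    have "(\<integral>\<^sup>+\<omega>1. ?c * ennreal (likelihood f \<sigma> (data_of t \<omega>2 y) \<omega>1) \<partial>M)
        = ?c * (\<integral>\<^sup>+\<omega>1. ennreal (likelihood f \<sigma> (data_of t \<omega>2 y) \<omega>1) \<partial>M)"
      using measurable_likelihood[OF \<sigma> data_points[OF \<omega>2]] by (intro nn_integral_cmult) simp
    then show ?thesis
      using posterior_tail[OF \<sigma> data_points[OF \<omega>2] x \<beta>, of t y] True
      by (simp add: density_of_conv_likelihood miss_def indicator_def)
  qed simp
  have "emeasure M {\<omega> \<in> space M. P (run t \<omega>) \<and> miss \<beta> x (run t \<omega>) \<omega>}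
      = (\<integral>\<^sup>+\<omega>. ?G ((\<omega>, \<omega>), obs_vec ?n \<omega>) \<partial>M)"
    using eq[OF Pmiss] by (simp add: run_conv_obs_vec)
  also have "\<dots> = (\<integral>\<^sup>+\<omega>2. \<integral>\<^sup>+y. \<integral>\<^sup>+\<omega>1. ?G ((\<omega>2, \<omega>1), y) * ennreal (density_of ?n \<omega>1 \<omega>2 y) \<partial>M \<partial>\<Lambda> ?n \<partial>M)"
    by (rule nn_integral_obs_vec_freeze[OF G])
  also have "\<dots> \<le> (\<integral>\<^sup>+\<omega>2. \<integral>\<^sup>+y. \<integral>\<^sup>+\<omega>1. (?c * ?I ((\<omega>2, \<omega>1), y)) * ennreal (density_of ?n \<omega>1 \<omega>2 y) \<partial>M \<partial>\<Lambda> ?n \<partial>M)"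
    by (intro nn_integral_mono inner)
  \<comment> \<open>The freezing identity is read backwards, which turns the bound into an
    expectation over the actual run again.\<close>
  also have "\<dots> = (\<integral>\<^sup>+\<omega>. ?c * ?I ((\<omega>, \<omega>), obs_vec ?n \<omega>) \<partial>M)"
    using G0 by (intro nn_integral_obs_vec_freeze[symmetric, where G="\<lambda>q. ?c * ?I q"] borel_measurable_times_ennreal) auto
  also have "\<dots> = ?c * (\<integral>\<^sup>+\<omega>. ?I ((\<omega>, \<omega>), obs_vec ?n \<omega>) \<partial>M)"
    by (intro nn_integral_cmult measurable_compose[OF M_N G0])
  also have "(\<integral>\<^sup>+\<omega>. ?I ((\<omega>, \<omega>), obs_vec ?n \<omega>) \<partial>M) = emeasure M {\<omega> \<in> space M. P (run t \<omega>)}"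
    using eq[OF Pm] by (simp add: run_conv_obs_vec)
  finally show ?thesis .
qed

lemma
  fixes N :: "'b measure"
  assumes W: "W \<in> N \<rightarrow>\<^sub>M algebra_of design" and Y: "\<And>i. i < n0 + t \<Longrightarrow> Y i \<in> borel_measurable N"
    and x: "x \<in> D"
  shows measurable_post_mean_data: "(\<lambda>w. post_mean k \<sigma> (data_of t (W w) (\<lambda>i. Y i w)) x) \<in> borel_measurable N"
    and measurable_post_var_data: "(\<lambda>w. post_var k \<sigma> (data_of t (W w) (\<lambda>i. Y i w)) x) \<in> borel_measurable N"
proof -
  have pts: "(\<lambda>w. point j (W w) (\<lambda>i. Y i w)) \<in> N \<rightarrow>\<^sub>M restrict_space borel D" if "j < n0 + t" for j
    using W Y that by (intro measurable_point) auto
  show "(\<lambda>w. post_mean k \<sigma> (data_of t (W w) (\<lambda>i. Y i w)) x) \<in> borel_measurable N"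
    unfolding data_of_conv_map by (intro borel_measurable_post_mean pts Y \<sigma> x)
  show "(\<lambda>w. post_var k \<sigma> (data_of t (W w) (\<lambda>i. Y i w)) x) \<in> borel_measurable N"
    unfolding data_of_conv_map by (intro borel_measurable_post_var pts Y \<sigma> x)
qed

lemma take_data_of: "t' \<le> t \<Longrightarrow> take (n0 + t') (data_of t \<omega> y) = data_of t' \<omega> y"
  by (simp add: data_of_conv_map take_map)

section \<open>First completion and the union bound\<close>

context
  fixes \<beta> h \<epsilon> \<delta> :: real
  assumes \<Omega>_D: "\<Omega> \<subseteq> D" and \<Omega>_nonempty: "\<Omega> \<noteq> {}" and \<delta>: "0 < \<delta>" "\<delta> < 1" and \<epsilon>: "0 < \<epsilon>"
    and \<beta>: "\<beta> = 2 * ln (real (card \<Omega>) / \<delta>)"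
begin

abbreviation "unclassified \<equiv> unclassified_set \<Omega> k \<sigma> \<beta> h \<epsilon>"
abbreviation "high \<equiv> high_set \<Omega> k \<sigma> \<beta> h \<epsilon>"
abbreviation "low \<equiv> low_set \<Omega> k \<sigma> \<beta> h \<epsilon>"

text \<open>First completion is encoded as a predicate of the current data list alone, earlier
  stages being recovered as prefixes, so that it can serve as P in
  \<open>posterior_tail_run\<close>.\<close>

definition completed_at :: "nat \<Rightarrow> 'a data \<Rightarrow> bool" where
  "completed_at t d \<longleftrightarrow> unclassified t d = {} \<and> (\<forall>t'<t. unclassified t' (take (n0 + t') d) \<noteq> {})"

lemma completed_at_run:
  "completed_at t (run t \<omega>) \<longleftrightarrow> unclassified t (run t \<omega>) = {} \<and> (\<forall>t'<t. unclassified t' (run t' \<omega>) \<noteq> {})"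
  by (auto simp: completed_at_def take_run)

lemma card_\<Omega>: "1 \<le> real (card \<Omega>)"
  using \<Omega> \<Omega>_nonempty by (simp add: Suc_le_eq card_gt_0_iff)

lemma \<beta>_nonneg: "0 \<le> \<beta>"
  unfolding \<beta> using card_\<Omega> \<delta> by (simp add: field_simps)

text \<open>\<beta> is chosen so that each point of \<Omega> receives an equal share of the failure
  probability \<delta>.\<close>

lemma exp_\<beta>: "exp (- \<beta> / 2) = \<delta> / real (card \<Omega>)"
proof -
  have "exp (- \<beta> / 2) = inverse (real (card \<Omega>) / \<delta>)"
    unfolding \<beta> using card_\<Omega> \<delta> by (simp add: exp_minus)
  then show ?thesis by simp
qed

lemma
  fixes N :: "'b measure"
  assumes W: "W \<in> N \<rightarrow>\<^sub>M algebra_of design" and Y: "\<And>i. i < n0 + t \<Longrightarrow> Y i \<in> borel_measurable N"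
    and x: "x \<in> \<Omega>"
  shows measurable_high: "Measurable.pred N (\<lambda>w. x \<in> high t (data_of t (W w) (\<lambda>i. Y i w)))"
    and measurable_low: "Measurable.pred N (\<lambda>w. x \<in> low t (data_of t (W w) (\<lambda>i. Y i w)))"
proof -
  have "x \<in> D" using x \<Omega>_D by auto
  note [measurable] = measurable_post_mean_data[OF W Y this] measurable_post_var_data[OF W Y this]
  show "Measurable.pred N (\<lambda>w. x \<in> high t (data_of t (W w) (\<lambda>i. Y i w)))"
    using x by (cases "t = 0") (simp_all add: high_set_def lower_bd_def)
  show "Measurable.pred N (\<lambda>w. x \<in> low t (data_of t (W w) (\<lambda>i. Y i w)))"
    using x by (cases "t = 0") (simp_all add: low_set_def upper_bd_def)
qed

lemma measurable_unclassified:
  fixes N :: "'b measure"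
  assumes "W \<in> N \<rightarrow>\<^sub>M algebra_of design" "\<And>i. i < n0 + t \<Longrightarrow> Y i \<in> borel_measurable N"
  shows "Measurable.pred N (\<lambda>w. unclassified t (data_of t (W w) (\<lambda>i. Y i w)) = {})"
proof -
  have "unclassified t d = {} \<longleftrightarrow> (\<forall>x\<in>\<Omega>. x \<in> high t d \<or> x \<in> low t d)" for d
    by (auto simp: unclassified_set_def classified_set_def)
  then show ?thesis
    using \<Omega> by (simp only:) (intro pred_intros_finite pred_intros_logic measurable_high[OF assms] measurable_low[OF assms])
qed

lemma measurable_completed_at:
  fixes N :: "'b measure"
  assumes "W \<in> N \<rightarrow>\<^sub>M algebra_of design" "\<And>i. i < n0 + t \<Longrightarrow> Y i \<in> borel_measurable N"
  shows "Measurable.pred N (\<lambda>w. completed_at t (data_of t (W w) (\<lambda>i. Y i w)))"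
proof -
  have "completed_at t (data_of t (W w) y) \<longleftrightarrow> unclassified t (data_of t (W w) y) = {}
      \<and> (\<forall>t'\<in>{..<t}. \<not> unclassified t' (data_of t' (W w) y) = {})" for w y
    by (auto simp: completed_at_def take_data_of)
  then show ?thesis
    using assms by (simp only:) (intro pred_intros_finite pred_intros_logic measurable_unclassified, auto)
qed

text \<open>As \<epsilon> is positive, the maxima with 0 drop out, and the comparison becomes a
  combination of measurable conditions. The alternative x \<notin> L on the right reflects the last
  branch of \<open>misspec_loss\<close>, which is also taken outside both sets.\<close>

lemma misspec_loss_le_iff:
  "misspec_loss h H L \<phi> x \<le> \<epsilon>
     \<longleftrightarrow> (x \<in> L \<longrightarrow> \<phi> x - h \<le> \<epsilon>) \<and> (x \<in> H \<or> x \<notin> L \<longrightarrow> h - \<phi> x \<le> \<epsilon>)"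
  using \<epsilon> by (auto simp: misspec_loss_def)

text \<open>Without a miss f(x) lies between the two confidence bounds, so the slack \<epsilon> in
  the classification rule is all that can be lost. At t = 0 nothing is classified, and the
  hypotheses contradict each other.\<close>

lemma loss_le_if_not_miss:
  assumes "unclassified t d = {}" "x \<in> \<Omega>" "\<not> miss \<beta> x d \<omega>"
  shows "misspec_loss h (high t d) (low t d) (\<lambda>x'. f x' \<omega>) x \<le> \<epsilon>"
proof -
  have "\<bar>f x \<omega> - post_mean k \<sigma> d x\<bar> \<le> sqrt \<beta> * sqrt (post_var k \<sigma> d x)"
    using assms(3) by (simp add: miss_def)
  then have "x \<in> high t d \<Longrightarrow> h - f x \<omega> \<le> \<epsilon>" "x \<in> low t d \<Longrightarrow> f x \<omega> - h \<le> \<epsilon>"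
    by (auto simp: high_set_def low_set_def lower_bd_def upper_bd_def split: if_splits)
  moreover have "x \<in> high t d \<or> x \<in> low t d"
    using assms(1,2) by (auto simp: unclassified_set_def classified_set_def)
  ultimately show ?thesis
    by (auto simp: misspec_loss_le_iff)
qed

definition success :: "'w \<Rightarrow> bool" where
  "success \<omega> \<longleftrightarrow> (let d = (\<lambda>t. run t \<omega>) in
     completes \<Omega> k \<sigma> \<beta> h \<epsilon> d \<longrightarrow>
     Max ((\<lambda>x. misspec_loss h (high_output \<Omega> k \<sigma> \<beta> h \<epsilon> d) (low_output \<Omega> k \<sigma> \<beta> h \<epsilon> d)
                 (\<lambda>x'. f x' \<omega>) x) ` \<Omega>) \<le> \<epsilon>)"

text \<open>At most one t is a time of first completion, and it is then the completion time.
  Quantifying over t instead of evaluating at a \<open>LEAST\<close> makes the event a countable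
  combination of measurable ones and matches it with \<open>posterior_tail_run\<close>.\<close>

lemma success_iff:
  "success \<omega> \<longleftrightarrow> (\<forall>t. completed_at t (run t \<omega>) \<longrightarrow>
     (\<forall>x\<in>\<Omega>. misspec_loss h (high t (run t \<omega>)) (low t (run t \<omega>)) (\<lambda>x'. f x' \<omega>) x \<le> \<epsilon>))"
proof -
  let ?T = "completion_time \<Omega> k \<sigma> \<beta> h \<epsilon> (\<lambda>t. run t \<omega>)"
  have T: "?T = t" if "completed_at t (run t \<omega>)" for t
    unfolding completion_time_def
    by (rule Least_equality) (use that in \<open>auto simp: completed_at_run not_less[symmetric]\<close>)
  have "completed_at ?T (run ?T \<omega>)" if "completes \<Omega> k \<sigma> \<beta> h \<epsilon> (\<lambda>t. run t \<omega>)"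
    using that LeastI_ex[of "\<lambda>t. unclassified t (run t \<omega>) = {}"]
    unfolding completes_def completed_at_run completion_time_def by (auto dest: not_less_Least)
  moreover have "completes \<Omega> k \<sigma> \<beta> h \<epsilon> (\<lambda>t. run t \<omega>)" if "completed_at t (run t \<omega>)" for t
    using that by (auto simp: completes_def completed_at_run)
  ultimately have compl: "completes \<Omega> k \<sigma> \<beta> h \<epsilon> (\<lambda>t. run t \<omega>) \<longleftrightarrow> completed_at ?T (run ?T \<omega>)"
    by blast
  have *: "(A T \<longrightarrow> B T) \<longleftrightarrow> (\<forall>t. A t \<longrightarrow> B t)" if "\<And>t. A t \<Longrightarrow> T = t" for A B and T :: nat
    using that by blast
  have "success \<omega> \<longleftrightarrow> (completed_at ?T (run ?T \<omega>) \<longrightarrow>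
     (\<forall>x\<in>\<Omega>. misspec_loss h (high ?T (run ?T \<omega>)) (low ?T (run ?T \<omega>)) (\<lambda>x'. f x' \<omega>) x \<le> \<epsilon>))"
    unfolding success_def Let_def high_output_def low_output_def compl
    using \<Omega> \<Omega>_nonempty by simp
  also have "\<dots> \<longleftrightarrow> (\<forall>t. completed_at t (run t \<omega>) \<longrightarrow>
     (\<forall>x\<in>\<Omega>. misspec_loss h (high t (run t \<omega>)) (low t (run t \<omega>)) (\<lambda>x'. f x' \<omega>) x \<le> \<epsilon>))"
    by (rule *[of "\<lambda>t. completed_at t (run t \<omega>)" ?T
          "\<lambda>t. \<forall>x\<in>\<Omega>. misspec_loss h (high t (run t \<omega>)) (low t (run t \<omega>)) (\<lambda>x'. f x' \<omega>) x \<le> \<epsilon>", OF T])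
  finally show ?thesis .
qed

proposition prob_success: "1 - \<delta> \<le> prob {\<omega> \<in> space M. success \<omega>}"
proof -
  let ?F = "\<lambda>t. {\<omega> \<in> space M. completed_at t (run t \<omega>)}"
  let ?B = "\<lambda>x t. {\<omega> \<in> space M. completed_at t (run t \<omega>) \<and> miss \<beta> x (run t \<omega>) \<omega>}"
  let ?q = "ennreal (\<delta> / real (card \<Omega>))"
  have id: "(\<lambda>\<omega>. \<omega>) \<in> M \<rightarrow>\<^sub>M algebra_of design"
    by (rule ident_algebra) (simp add: design_subset)
  note [measurable] = measurable_completed_at[OF id, of _ obs, folded run_conv_data_of]
    measurable_high[OF id, of _ obs, folded run_conv_data_of]
    measurable_low[OF id, of _ obs, folded run_conv_data_of]
    measurable_post_mean_data[OF id, of _ obs, folded run_conv_data_of]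
    measurable_post_var_data[OF id, of _ obs, folded run_conv_data_of]
    measurable_obs_M
  have f[measurable]: "f x \<in> borel_measurable M" if "x \<in> \<Omega>" for x
    using that \<Omega>_D by (intro rv_f) auto
  have F: "?F t \<in> sets M" for t
    by measurable
  have B: "?B x t \<in> sets M" if "x \<in> \<Omega>" for x t
  proof -
    have [measurable]: "x \<in> D" "x \<in> \<Omega>" using that \<Omega>_D by auto
    show ?thesis unfolding miss_def by measurable
  qed
  have "Measurable.pred M success"
    unfolding success_iff[abs_def] misspec_loss_le_iff
    using \<Omega> by (intro pred_intros_countable pred_intros_logic pred_intros_finite) measurable
  then have G: "{\<omega> \<in> space M. success \<omega>} \<in> sets M"
    by (simp add: pred_def)
  have "disjoint_family ?F"
    unfolding disjoint_family_on_def completed_at_run by (metis (no_types, lifting) Int_emptyI linorder_neqE_nat mem_Collect_eq)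
  then have sumF: "(\<Sum>t. emeasure M (?F t)) \<le> 1"
    using F by (subst suminf_emeasure) (auto intro: emeasure_le_1)
  have Bx: "emeasure M (\<Union>t. ?B x t) \<le> ?q" if x: "x \<in> \<Omega>" for x
  proof -
    have "emeasure M (\<Union>t. ?B x t) \<le> (\<Sum>t. emeasure M (?B x t))"
      using B[OF x] by (intro emeasure_subadditive_countably) auto
    also have "\<dots> \<le> (\<Sum>t. ?q * emeasure M (?F t))"
    proof (intro suminf_le summableI)
      fix t
      have "Measurable.pred (algebra_of design \<Otimes>\<^sub>M \<Lambda> (n0 + t)) (\<lambda>p. completed_at t (data_of t (fst p) (snd p)))"
        using measurable_completed_at[OF measurable_fst, where Y="\<lambda>i p. snd p i"]
          measurable_compose[OF measurable_snd measurable_PiM_lborel_component] by auto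
      then show "emeasure M (?B x t) \<le> ?q * emeasure M (?F t)"
        using posterior_tail_run[where x=x and \<beta>=\<beta> and t=t and P="completed_at t"] x \<Omega>_D \<beta>_nonneg
        unfolding exp_\<beta>[symmetric] by auto
    qed
    also have "\<dots> = ?q * (\<Sum>t. emeasure M (?F t))" by simp
    also have "\<dots> \<le> ?q * 1" by (intro mult_left_mono sumF) simp
    finally show ?thesis by simp
  qed
  have "space M - {\<omega> \<in> space M. success \<omega>} \<subseteq> (\<Union>x\<in>\<Omega>. \<Union>t. ?B x t)"
  proof
    fix \<omega> assume \<omega>: "\<omega> \<in> space M - {\<omega> \<in> space M. success \<omega>}"
    then obtain t x where tx: "completed_at t (run t \<omega>)" "x \<in> \<Omega>"
      "\<not> misspec_loss h (high t (run t \<omega>)) (low t (run t \<omega>)) (\<lambda>x'. f x' \<omega>) x \<le> \<epsilon>"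
      by (auto simp: success_iff)
    then have "miss \<beta> x (run t \<omega>) \<omega>"
      using loss_le_if_not_miss[of t "run t \<omega>" x \<omega>] by (auto simp: completed_at_run)
    with \<omega> tx show "\<omega> \<in> (\<Union>x\<in>\<Omega>. \<Union>t. ?B x t)" by auto
  qed
  then have "emeasure M (space M - {\<omega> \<in> space M. success \<omega>}) \<le> emeasure M (\<Union>x\<in>\<Omega>. \<Union>t. ?B x t)"
    using B \<Omega> by (intro emeasure_mono sets.finite_UN sets.countable_UN) auto
  also have "\<dots> \<le> (\<Sum>x\<in>\<Omega>. emeasure M (\<Union>t. ?B x t))"
    using B \<Omega> by (intro emeasure_subadditive_finite) auto
  also have "\<dots> \<le> (\<Sum>x\<in>\<Omega>. ?q)"
    by (intro sum_mono Bx)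
  also have "\<dots> = ennreal \<delta>"
    using card_\<Omega> \<delta> by (simp add: ennreal_of_nat_eq_real_of_nat ennreal_mult[symmetric])
  finally have "prob (space M - {\<omega> \<in> space M. success \<omega>}) \<le> \<delta>"
    using \<delta> by (simp add: emeasure_eq_measure)
  with prob_compl[OF G] show ?thesis by simp
qed

end

end

theorem theorem1:
  fixes M :: "'w measure"
    and D \<Omega> :: "'a::euclidean_space set"
    and k :: "'a \<Rightarrow> 'a \<Rightarrow> real"
    and f :: "'a \<Rightarrow> 'w \<Rightarrow> real"
    and \<sigma> h \<delta> \<epsilon> \<beta> :: real
    and K n0 :: nat
    and c p \<kappa> :: "nat \<Rightarrow> real"
    and g :: "'p \<Rightarrow> 'a \<Rightarrow> real"
    and \<theta> :: "'a \<Rightarrow> nat \<Rightarrow> 'p"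
    and s0 :: "nat \<Rightarrow> 'w \<Rightarrow> 'a"
    and r :: "nat \<Rightarrow> 'w \<Rightarrow> bool"
    and C :: "nat \<Rightarrow> 'w \<Rightarrow> 'a \<times> nat"
    and S :: "nat \<Rightarrow> 'a \<Rightarrow> nat \<Rightarrow> 'w \<Rightarrow> 'a"
    and \<rho> :: "nat \<Rightarrow> 'w \<Rightarrow> real"
    and pick :: "nat \<Rightarrow> 'a data \<Rightarrow> 'a \<times> nat"
  assumes "prob_space M"
    and "D \<in> sets borel" and "finite \<Omega>" and "\<Omega> \<noteq> {}" and "\<Omega> \<subseteq> D"
    and "0 < \<sigma>" and "0 < \<delta>" and "\<delta> < 1" and "0 < \<epsilon>"
    and beta: "\<beta> = 2 * ln (real (card \<Omega>) / \<delta>)"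
    and costs: "\<And>i. i \<in> {1..K} \<Longrightarrow> 0 < c i" "strict_mono_on {1..K} c"
    and probs: "\<And>t. 1 \<le> t \<Longrightarrow> p t \<in> {0..1}"
    and kappas: "\<And>i. i \<in> {1..K} \<Longrightarrow> \<kappa> i \<in> {0<..<1}" "real (card \<Omega>) * (\<Sum>i\<in>{1..K}. \<kappa> i) = 1"
    and kernel: "pos_def_kernel D k"
    and prior: "gaussian_process M D k f"
    and init: "\<And>j. j < n0 \<Longrightarrow> s0 j \<in> borel_measurable M"
      "\<And>j \<omega>. j < n0 \<Longrightarrow> \<omega> \<in> space M \<Longrightarrow> s0 j \<omega> \<in> D"
    and bern: "\<And>t. 1 \<le> t \<Longrightarrow> r t \<in> M \<rightarrow>\<^sub>M count_space UNIV"
      "\<And>t. 1 \<le> t \<Longrightarrow> distr M (count_space UNIV) (r t) = measure_pmf (bernoulli_pmf (p t))"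
    and cand: "\<And>t. 1 \<le> t \<Longrightarrow> C t \<in> M \<rightarrow>\<^sub>M count_space (\<Omega> \<times> {1..K})"
      "\<And>t x i. 1 \<le> t \<Longrightarrow> x \<in> \<Omega> \<Longrightarrow> i \<in> {1..K} \<Longrightarrow> measure M {\<omega> \<in> space M. C t \<omega> = (x, i)} = \<kappa> i"
    and dens: "\<And>x i s. x \<in> \<Omega> \<Longrightarrow> i \<in> {1..K} \<Longrightarrow> 0 \<le> g (\<theta> x i) s"
    and input: "\<And>t x i. 1 \<le> t \<Longrightarrow> x \<in> \<Omega> \<Longrightarrow> i \<in> {1..K} \<Longrightarrow>
        distributed M lborel (S t x i) (\<lambda>s. ennreal (g (\<theta> x i) s))"
      "\<And>t x i \<omega>. 1 \<le> t \<Longrightarrow> x \<in> \<Omega> \<Longrightarrow> i \<in> {1..K} \<Longrightarrow> \<omega> \<in> space M \<Longrightarrow> S t x i \<omega> \<in> D"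
    and noise: "\<And>j. distributed M lborel (\<rho> j) (\<lambda>y. ennreal (normal_density 0 \<sigma> y))"
    and indep: "independent_sources M D \<Omega> K f n0 s0 r C S \<rho>"
    and rule: "acquisition_rule D \<Omega> k \<sigma> \<beta> h \<epsilon> K c g \<theta> n0 pick"
  shows "measure M {\<omega> \<in> space M.
      let d = (\<lambda>t. run_data f n0 s0 r C S \<rho> pick t \<omega>) in
        completes \<Omega> k \<sigma> \<beta> h \<epsilon> d \<longrightarrow>
        Max ((\<lambda>x. misspec_loss h (high_output \<Omega> k \<sigma> \<beta> h \<epsilon> d) (low_output \<Omega> k \<sigma> \<beta> h \<epsilon> d)
                    (\<lambda>x'. f x' \<omega>) x) ` \<Omega>) \<le> \<epsilon>}
    \<ge> 1 - \<delta>"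
proof -
  interpret prob_space M by (rule assms)
  interpret classification_run M D k f \<Omega> \<sigma> K n0 s0 r C S \<rho> pick
  proof
    show "C t \<omega> \<in> \<Omega> \<times> {1..K}" if "1 \<le> t" "\<omega> \<in> space M" for t \<omega>
      using measurable_space[OF cand(1)[OF that(1)] that(2)] by simp
    show "indep_sets (\<lambda>src. sets (source_algebra M D \<Omega> K f n0 s0 r C S \<rho> src)) sources"
      using indep by (simp add: independent_sources_def)
    show "(\<lambda>z. pick t (map z [0..<n0 + t])) \<in> PiM {..<n0 + t} (\<lambda>_. borel) \<rightarrow>\<^sub>M count_space (\<Omega> \<times> {1..K})" for t
      using rule by (simp add: acquisition_rule_def)
  qed (use assms in auto)
  show ?thesis
    using prob_success[OF \<open>\<Omega> \<subseteq> D\<close> \<open>\<Omega> \<noteq> {}\<close> \<open>0 < \<delta>\<close> \<open>\<delta> < 1\<close> \<open>0 < \<epsilon>\<close> beta, of h]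
    unfolding success_def[OF \<open>\<Omega> \<subseteq> D\<close> \<open>\<Omega> \<noteq> {}\<close> \<open>0 < \<delta>\<close> \<open>\<delta> < 1\<close> \<open>0 < \<epsilon>\<close> beta] .
qed

end
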